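(* For every $1<\alpha<2$, there exist rotational 2D reflection symmetric $(-\alpha)$-homogeneous solutions $u\in C^{2}(\mathbb{R}^{2}\setminus\{0\})$ of the stationary incompressible Euler equations whose stream function level sets are homeomorphic to those of the irrotational $(-2)$-homogeneous solution; that is, the stream function $\psi$ of $u$ is such that for every $C\in\mathbb{R}$ the level set $\{x\in\mathbb{R}^2\setminus\{0\}:\psi(x)=C\}$ is homeomorphic to $\{x\in\mathbb{R}^2\setminus\{0\}:\psi_0(x)=C\}$, where $\psi_0=\sin\phi/r$.
   Context: The Euler equations are $u\cdot\nabla u+\nabla p=0$, $\nabla\cdot u=0$. Here $u=(u^1,u^2,0)$ and $p$ depend only on $(x_1,x_2)$ and the equations hold classically in $\mathbb{R}^2\setminus\{0\}$; $(r,\phi)$ are polar coordinates in the $(x_1,x_2)$-plane. $(u,p)$ is $(-\alpha)$-homogeneous if for all $\lambda>0$, $u(x)=\lambda^{\alpha}u(\lambda x)$ and $p(x)=\lambda^{2\alpha}p(\lambda x)$. 2D reflection symmetric means $u^{1}(x_1,x_2)=u^{1}(x_1,-x_2)$, $u^{2}(x_1,x_2)=-u^{2}(x_1,-x_2)$, $p(x_1,x_2)=p(x_1,-x_2)$. Rotational means that $\omega=\partial_1u^2-\partial_2u^1$ is not identically zero. The stream function of $u$ is the function $\psi$ on $\mathbb{R}^2\setminus\{0\}$ with $u=(\partial_2\psi,-\partial_1\psi,0)$, homogeneous of degree $1-\alpha$, i.e. $\psi=w(\phi)/r^{\alpha-1}$. The irrotational 2D reflection symmetric $(-2)$-homogeneous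 solution is (up to a constant multiple) the one with stream function $\psi_0=\sin\phi/r$. *)

theory Defs
  imports "HOL-Analysis.Analysis"
begin

text \<open>
  The fields \<open>(u\<^sup>1, u\<^sup>2, 0)\<close> and \<open>p\<close> depend only on \<open>(x\<^sub>1, x\<^sub>2)\<close>; the third momentum equation and the
  \<open>x\<^sub>3\<close>-derivatives vanish identically. We therefore represent the velocity by its first two
  components, as a map \<open>real^2 \<Rightarrow> real^2\<close>. All functions are total in HOL, and their values at the
  origin are never used.
\<close>

abbreviation punctured_plane :: "(real^2) set" where
  "punctured_plane \<equiv> UNIV - {0}"

definition pd :: "2 \<Rightarrow> (real^2 \<Rightarrow> 'b::real_normed_vector) \<Rightarrow> real^2 \<Rightarrow> 'b" where
  "pd i f x = frechet_derivative f (at x) (axis i 1)"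

text \<open>\<open>C_k k S f\<close>: on the open set \<open>S\<close>, \<open>f\<close> is \<open>k\<close> times continuously differentiable.\<close>

primrec C_k :: "nat \<Rightarrow> (real^2) set \<Rightarrow> (real^2 \<Rightarrow> 'b::real_normed_vector) \<Rightarrow> bool" where
  "C_k 0 S f \<longleftrightarrow> continuous_on S f"
| "C_k (Suc k) S f \<longleftrightarrow> (\<forall>x\<in>S. f differentiable (at x)) \<and> (\<forall>i. C_k k S (pd i f))"

definition euler_solution :: "(real^2 \<Rightarrow> real^2) \<Rightarrow> (real^2 \<Rightarrow> real) \<Rightarrow> bool" where
  "euler_solution u p \<longleftrightarrow>
     C_k 1 punctured_plane u \<and> C_k 1 punctured_plane p \<and>
     (\<forall>x\<in>punctured_plane.
        (\<forall>i. (\<Sum>j\<in>UNIV. u x $ j * pd j (\<lambda>y. u y $ i) x) + pd i p x = 0) \<and>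
        (\<Sum>j\<in>UNIV. pd j (\<lambda>y. u y $ j) x) = 0)"

definition neg_homogeneous :: "real \<Rightarrow> (real^2 \<Rightarrow> real^2) \<Rightarrow> (real^2 \<Rightarrow> real) \<Rightarrow> bool" where
  "neg_homogeneous \<alpha> u p \<longleftrightarrow>
     (\<forall>c>0. \<forall>x\<in>punctured_plane.
        u x = (c powr \<alpha>) *\<^sub>R u (c *\<^sub>R x) \<and>
        p x = c powr (2 * \<alpha>) * p (c *\<^sub>R x))"

definition reflect :: "real^2 \<Rightarrow> real^2" where
  "reflect x = vector [x $ 1, - x $ 2]"

definition reflection_symmetric :: "(real^2 \<Rightarrow> real^2) \<Rightarrow> (real^2 \<Rightarrow> real) \<Rightarrow> bool" where
  "reflection_symmetric u p \<longleftrightarrow>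
     (\<forall>x\<in>punctured_plane.
        u x $ 1 = u (reflect x) $ 1 \<and>
        u x $ 2 = - u (reflect x) $ 2 \<and>
        p x = p (reflect x))"

definition vorticity :: "(real^2 \<Rightarrow> real^2) \<Rightarrow> real^2 \<Rightarrow> real" where
  "vorticity u x = pd 1 (\<lambda>y. u y $ 2) x - pd 2 (\<lambda>y. u y $ 1) x"

definition rotational :: "(real^2 \<Rightarrow> real^2) \<Rightarrow> bool" where
  "rotational u \<longleftrightarrow> (\<exists>x\<in>punctured_plane. vorticity u x \<noteq> 0)"

text \<open>
  The last clause (homogeneity of degree \<open>1 - \<alpha>\<close>) fixes the additive constant when \<open>\<alpha> \<noteq> 1\<close>, so
  that the stream function is unique on the punctured plane.
\<close>

definition stream_function ::
    "real \<Rightarrow> (real^2 \<Rightarrow> real^2) \<Rightarrow> (real^2 \<Rightarrow> real) \<Rightarrow> bool" where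
  "stream_function \<alpha> u \<psi> \<longleftrightarrow>
     (\<forall>x\<in>punctured_plane.
        \<psi> differentiable (at x) \<and> u x $ 1 = pd 2 \<psi> x \<and> u x $ 2 = - pd 1 \<psi> x) \<and>
     (\<forall>c>0. \<forall>x\<in>punctured_plane. \<psi> (c *\<^sub>R x) = c powr (1 - \<alpha>) * \<psi> x)"

text \<open>\<open>\<psi>\<^sub>0 = sin \<phi> / r\<close>; the choice of branch of the angle is immaterial.\<close>

definition \<psi>0 :: "real^2 \<Rightarrow> real" where
  "\<psi>0 x = sin (Arg (Complex (x $ 1) (x $ 2))) / norm x"

definition level_set :: "(real^2 \<Rightarrow> real) \<Rightarrow> real \<Rightarrow> (real^2) set" where
  "level_set \<psi> C = {x \<in> punctured_plane. \<psi> x = C}"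

end

theory Submission
  imports Defs
begin

text \<open>
  Put \<open>\<beta> = \<alpha> - 1 \<in> (0, 1)\<close> and look for \<open>\<psi> = r powr (- \<beta>) * w \<phi>\<close>. The vorticity is constant along
  streamlines as soon as \<open>w'' + \<beta>\<^sup>2 w + c \<bar>w\<bar> powr (2 / \<beta>) * w = 0\<close>, and then the pressure is a constant
  multiple of \<open>r powr (- 2 * \<alpha>)\<close>. With amplitude \<open>1\<close> and \<open>c = k * (1 + 1 / \<beta>)\<close> the energy identity is
  \<open>w'\<^sup>2 = \<beta>\<^sup>2 (1 - w\<^sup>2) + k (1 - \<bar>w\<bar> powr (2 + 2 / \<beta>))\<close>. The substitution \<open>w = sin \<Theta>\<close> removes the square
  root singularity at the turning points: \<open>\<Theta>' = sqrt (V k \<Theta>)\<close> with \<open>V k\<close> continuous and positive.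
  The half-period \<open>T k\<close>, the integral of \<open>1 / sqrt (V k \<theta>)\<close> over \<open>[0, \<pi>]\<close>, equals \<open>\<pi> / \<beta> > \<pi>\<close> at \<open>k = 0\<close>
  and is at most \<open>\<pi>\<close> at \<open>k = 1 - \<beta>\<^sup>2\<close>; so some \<open>k > 0\<close> has half-period exactly \<open>\<pi>\<close>. The resulting odd
  profile is positive on \<open>(0, \<pi>)\<close>, as is \<open>sin\<close>, and radial projection maps each nonzero
  level set of either stream function homeomorphically onto an open half circle.
\<close>

subsection \<open>Homogeneous functions in polar coordinates\<close>

abbreviation angle :: "real^2 \<Rightarrow> real" where
  "angle x \<equiv> Arg (Complex (x $ 1) (x $ 2))"

text \<open>The degree of homogeneity is \<open>- s\<close>. The profile \<open>g\<close> is meant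
  to be \<open>2 * pi\<close>-periodic: only then is the function continuous across the cut of
  \<open>Arg\<close> for continuous \<open>g\<close>.\<close>

definition polar_hom :: "real \<Rightarrow> (real \<Rightarrow> real) \<Rightarrow> real^2 \<Rightarrow> real" where
  "polar_hom s g x = norm x powr (-s) * g (angle x)"

lemma cmod_Complex_vec: "cmod (Complex (x $ 1) (x $ 2)) = norm (x :: real^2)"
  by (simp add: norm_vec_def L2_set_def sum_2 cmod_def)

lemma norm_vec2_sq: "(norm (x :: real^2))\<^sup>2 = (x $ 1)\<^sup>2 + (x $ 2)\<^sup>2"
  by (simp add: norm_vec_def L2_set_def sum_2)

lemma Complex_vec_eq_0_iff: "Complex (x $ 1) (x $ 2) = 0 \<longleftrightarrow> (x :: real^2) = 0"
  by (metis cmod_Complex_vec norm_eq_zero)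

lemma cos_sin_angle:
  assumes "x \<noteq> 0"
  shows "cos (angle x) = x $ 1 / norm x" "sin (angle x) = x $ 2 / norm x"
  using assms by (simp_all add: cos_Arg sin_Arg Complex_vec_eq_0_iff cmod_Complex_vec)

text \<open>Angles with equal cosine and sine differ by an integer multiple of
  \<open>2 * pi\<close>. This is how one branch of the angle is exchanged for another inside a
  periodic profile.\<close>

lemma periodic_eqI:
  fixes g :: "real \<Rightarrow> 'a"
  assumes per: "\<And>t. g (t + 2 * pi) = g t" and "cos a = cos b" "sin a = sin b"
  shows "g a = g b"
proof -
  have nat: "g (t + 2 * pi * real n) = g t" for t n
  proof (induction n)
    case (Suc n)
    have "g (t + 2 * pi * real (Suc n)) = g ((t + 2 * pi * real n) + 2 * pi)"
      by (simp add: algebra_simps)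
    then show ?case using per[of "t + 2 * pi * real n"] Suc by simp
  qed simp
  have int: "g (t + 2 * pi * of_int n) = g t" for t n
  proof (cases "n \<ge> 0")
    case True
    then show ?thesis using nat[of t "nat n"] by simp
  next
    case False
    then show ?thesis using nat[of "t + 2 * pi * of_int n" "nat (- n)"] by simp
  qed
  obtain n :: int where "a = b + 2 * pi * of_int n"
    using assms(2,3) sin_cos_eq_iff[of a b] by auto
  then show ?thesis using int by simp
qed

lemma periodic_deriv:
  fixes g :: "real \<Rightarrow> real"
  assumes per: "\<And>t. g (t + c) = g t" and dg: "\<And>t. (g has_real_derivative g' t) (at t)"
  shows "g' (t + c) = g' t"
proof -
  have "((\<lambda>t. g (t + c)) has_real_derivative g' (t + c)) (at t)"
    using dg[of "t + c"] by (simp add: DERIV_shift)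
  moreover have "(\<lambda>t. g (t + c)) = g" using per by blast
  ultimately show ?thesis using dg[of t] DERIV_unique by metis
qed

text \<open>Near the negative half-axis, the jump of the principal angle is avoided by measuring the
  angle of \<open>-y\<close> instead.\<close>

lemma local_angle:
  fixes x :: "real^2"
  assumes "x \<noteq> 0"
  obtains A where
    "(A has_derivative (\<lambda>h. (x $ 1 * h $ 2 - x $ 2 * h $ 1) / (norm x)\<^sup>2)) (at x)"
    "\<And>y. y \<noteq> 0 \<Longrightarrow> cos (A y) = cos (angle y)" "\<And>y. y \<noteq> 0 \<Longrightarrow> sin (A y) = sin (angle y)"
proof -
  define Z :: "real^2 \<Rightarrow> complex" where "Z y = Complex (y $ 1) (y $ 2)" for y
  have blZ: "bounded_linear Z"
    unfolding Z_def Complex_eq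
    by (intro bounded_linear_add bounded_linear_of_real[THEN bounded_linear_compose]
        bounded_linear_mult_right[THEN bounded_linear_compose] bounded_linear_vec_nth)
  have Z0: "Z y \<noteq> 0" if "y \<noteq> 0" for y using that by (simp add: Z_def Complex_vec_eq_0_iff)
  \<comment> \<open>The factor \<open>e\<close> is \<open>1\<close> or \<open>- 1\<close>, depending
    on the side on which the logarithm is smooth. It cancels in the logarithmic derivative, so both
    branches have the derivative \<open>Im (Z h / Z x)\<close>.\<close>
  have der: "((\<lambda>y. Im (Ln (e * Z y))) has_derivative
      (\<lambda>h. (x $ 1 * h $ 2 - x $ 2 * h $ 1) / (norm x)\<^sup>2)) (at x)"
    if "e * Z x \<notin> \<real>\<^sub>\<le>\<^sub>0" "e \<noteq> 0" for e
  proof -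
    have "(Ln has_derivative (\<lambda>h. inverse (e * Z x) * h)) (at (e * Z x))"
      using has_field_derivative_Ln[OF that(1)] by (simp add: has_field_derivative_def)
    moreover have "((\<lambda>y. e * Z y) has_derivative (\<lambda>h. e * Z h)) (at x)"
      by (intro has_derivative_mult_right bounded_linear_imp_has_derivative blZ)
    ultimately have "((\<lambda>y. Ln (e * Z y)) has_derivative (\<lambda>h. inverse (e * Z x) * (e * Z h))) (at x)"
      by (rule has_derivative_compose[rotated])
    then have "((\<lambda>y. Im (Ln (e * Z y))) has_derivative (\<lambda>h. Im (inverse (e * Z x) * (e * Z h)))) (at x)"
      by (rule has_derivative_Im)
    moreover have "inverse (e * Z x) * (e * Z h) = Z h / Z x" for h
      using that(2) Z0[OF assms] by (simp add: field_simps)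
    moreover have "Im (Z h / Z x) = (x $ 1 * h $ 2 - x $ 2 * h $ 1) / (norm x)\<^sup>2" for h
      by (simp add: Im_divide Z_def norm_vec2_sq algebra_simps)
    ultimately show ?thesis by (simp only:)
  qed
  show thesis
  proof (cases "Z x \<in> \<real>\<^sub>\<le>\<^sub>0")
    case False
    show thesis
    proof (rule that)
      show "((\<lambda>y. Im (Ln (1 * Z y))) has_derivative
          (\<lambda>h. (x $ 1 * h $ 2 - x $ 2 * h $ 1) / (norm x)\<^sup>2)) (at x)"
        by (rule der) (use False in auto)
      show "cos (Im (Ln (1 * Z y))) = cos (angle y)" "sin (Im (Ln (1 * Z y))) = sin (angle y)"
        if "y \<noteq> 0" for y
        using Z0[OF that] by (simp_all add: Arg_eq_Im_Ln Z_def)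
    qed
  next
    case True
    then have "Z x \<notin> \<real>\<^sub>\<ge>\<^sub>0"
      using Z0[OF assms] by (auto simp: complex_nonneg_Reals_iff complex_nonpos_Reals_iff complex_eq_iff)
    then have d: "((\<lambda>y. Im (Ln (- 1 * Z y))) has_derivative
          (\<lambda>h. (x $ 1 * h $ 2 - x $ 2 * h $ 1) / (norm x)\<^sup>2)) (at x)"
      by (intro der) (auto simp: complex_nonneg_Reals_iff complex_nonpos_Reals_iff)
    show thesis
    proof (rule that)
      show "((\<lambda>y. Im (Ln (- 1 * Z y)) + pi) has_derivative
          (\<lambda>h. (x $ 1 * h $ 2 - x $ 2 * h $ 1) / (norm x)\<^sup>2)) (at x)"
        using has_derivative_add[OF d has_derivative_const[of pi]] by simp
      show "cos (Im (Ln (- 1 * Z y)) + pi) = cos (angle y)"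
           "sin (Im (Ln (- 1 * Z y)) + pi) = sin (angle y)"
        if "y \<noteq> 0" for y
        using Z0[OF that] by (simp_all add: Arg_eq_Im_Ln[symmetric] Z_def cos_Arg sin_Arg)
    qed
  qed
qed

lemma has_derivative_transform_open:
  assumes "(f has_derivative D) (at x)" "open S" "x \<in> S" "\<And>y. y \<in> S \<Longrightarrow> f y = g y"
  shows "(g has_derivative D) (at x)"
  using has_derivative_transform_within_open[of f D x UNIV S g] assms by auto

lemma open_punctured_plane: "open punctured_plane"
  by (simp add: open_delete)

text \<open>Chain rule with d/dx1 = cos t d/dr - (sin t / r) d/dt and d/dx2 = sin t d/dr + (cos t /
  r) d/dt. Both partial derivatives are again of the form \<open>polar_hom\<close>, with exponent
  \<open>s + 1\<close>, so that the calculus on the plane reduces to identities between functions of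
  one angle.\<close>

lemma has_derivative_polar_hom:
  assumes per: "\<And>t. g (t + 2 * pi) = g t"
    and dg: "\<And>t. (g has_real_derivative g' t) (at t)"
    and x: "x \<noteq> 0"
  shows "(polar_hom s g has_derivative (\<lambda>h.
           h $ 1 * polar_hom (s + 1) (\<lambda>t. - s * cos t * g t - sin t * g' t) x +
           h $ 2 * polar_hom (s + 1) (\<lambda>t. - s * sin t * g t + cos t * g' t) x)) (at x)"
proof -
  obtain A where A: "(A has_derivative (\<lambda>h. (x $ 1 * h $ 2 - x $ 2 * h $ 1) / (norm x)\<^sup>2)) (at x)"
    and A_eq: "\<And>y. y \<noteq> 0 \<Longrightarrow> cos (A y) = cos (angle y)" "\<And>y. y \<noteq> 0 \<Longrightarrow> sin (A y) = sin (angle y)"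
    using local_angle[OF x] by blast
  have per': "g' (t + 2 * pi) = g' t" for t by (rule periodic_deriv[OF per dg])
  \<comment> \<open>\<open>A\<close> is differentiable at \<open>x\<close> even where
    \<open>angle\<close> jumps, and the periodic \<open>g\<close> cannot tell the two apart.\<close>
  have gA: "g (A y) = g (angle y)" if "y \<noteq> 0" for y
    using periodic_eqI[of g, OF per] A_eq[OF that] by blast
  have g'A: "g' (A x) = g' (angle x)"
    using periodic_eqI[of g', OF per'] A_eq[OF x] by blast
  have n: "norm x > 0" using x by simp
  have dgA: "((\<lambda>y. g (A y)) has_derivative
      (\<lambda>h. g' (A x) * ((x $ 1 * h $ 2 - x $ 2 * h $ 1) / (norm x)\<^sup>2))) (at x)"
    using has_derivative_compose[OF A, of g "\<lambda>h. g' (A x) * h"] dg[of "A x"]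
    by (simp add: has_field_derivative_def)
  have dn: "((\<lambda>y. norm y powr (-s)) has_derivative
      (\<lambda>h. (- s * norm x powr (- s - 1)) * (h \<bullet> sgn x))) (at x)"
  proof -
    have "((\<lambda>r. r powr (-s)) has_derivative (*) (- s * norm x powr (- s - 1))) (at (norm x))"
      using has_real_derivative_powr[OF n, of "-s"] by (simp only: has_field_derivative_def)
    from has_derivative_compose[OF has_derivative_norm[OF x] this] show ?thesis .
  qed
  have "((\<lambda>y. norm y powr (-s) * g (A y)) has_derivative
     (\<lambda>h. norm x powr (-s) * (g' (A x) * ((x $ 1 * h $ 2 - x $ 2 * h $ 1) / (norm x)\<^sup>2)) +
       (- s * norm x powr (- s - 1)) * (h \<bullet> sgn x) * g (A x))) (at x)"
    by (rule has_derivative_mult[OF dn dgA])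
  moreover have "norm x powr (-s) * (g' (A x) * ((x $ 1 * h $ 2 - x $ 2 * h $ 1) / (norm x)\<^sup>2)) +
       (- s * norm x powr (- s - 1)) * (h \<bullet> sgn x) * g (A x) =
     h $ 1 * polar_hom (s + 1) (\<lambda>t. - s * cos t * g t - sin t * g' t) x +
           h $ 2 * polar_hom (s + 1) (\<lambda>t. - s * sin t * g t + cos t * g' t) x" for h
  proof -
    have p: "norm x powr (-s) = norm x powr (- s - 1) * norm x"
      using n powr_add[of "norm x" "- s - 1" 1] by simp
    have i: "h \<bullet> sgn x = (h $ 1 * x $ 1 + h $ 2 * x $ 2) / norm x"
      by (simp add: inner_vec_def sum_2 sgn_div_norm add_divide_distrib divide_inverse algebra_simps)
    define q where "q = norm x powr (- s - 1)"
    have q: "norm x powr - (s + 1) = q" unfolding q_def minus_add_distrib by simp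
    show ?thesis
      unfolding polar_hom_def g'A gA[OF x] i p q cos_sin_angle[OF x] q_def[symmetric]
      using n by (simp add: field_simps power2_eq_square)
  qed
  ultimately have "((\<lambda>y. norm y powr (-s) * g (A y)) has_derivative (\<lambda>h.
           h $ 1 * polar_hom (s + 1) (\<lambda>t. - s * cos t * g t - sin t * g' t) x +
           h $ 2 * polar_hom (s + 1) (\<lambda>t. - s * sin t * g t + cos t * g' t) x)) (at x)"
    by simp
  then show ?thesis
    by (rule has_derivative_transform_open[OF _ open_punctured_plane])
      (use x gA in \<open>auto simp: polar_hom_def\<close>)
qed

lemma pd_eqI: "(f has_derivative D) (at x) \<Longrightarrow> pd i f x = D (axis i 1)"
  unfolding pd_def by (simp only: frechet_derivative_at[symmetric])

lemma pd_polar_hom: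
  assumes "\<And>t. g (t + 2 * pi) = g t" "\<And>t. (g has_real_derivative g' t) (at t)" "x \<noteq> 0"
  shows "pd 1 (polar_hom s g) x = polar_hom (s + 1) (\<lambda>t. - s * cos t * g t - sin t * g' t) x"
    and "pd 2 (polar_hom s g) x = polar_hom (s + 1) (\<lambda>t. - s * sin t * g t + cos t * g' t) x"
  by (subst pd_eqI[OF has_derivative_polar_hom[of g g' x s, OF assms]], simp add: axis_def)+

section \<open>Transfer of regularity from angular profiles to the punctured plane\<close>

lemma continuous_on_polar_hom:
  assumes "\<And>t. g (t + 2 * pi) = g t" "continuous_on UNIV g"
  shows "continuous_on punctured_plane (polar_hom s g)"
proof (rule continuous_at_imp_continuous_on, rule ballI)
  fix x :: "real^2" assume x_in: "x \<in> punctured_plane"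
  then have x: "x \<noteq> 0" by simp
  obtain A where A: "(A has_derivative (\<lambda>h. (x $ 1 * h $ 2 - x $ 2 * h $ 1) / (norm x)\<^sup>2)) (at x)"
    and A_eq: "\<And>y. y \<noteq> 0 \<Longrightarrow> cos (A y) = cos (angle y)" "\<And>y. y \<noteq> 0 \<Longrightarrow> sin (A y) = sin (angle y)"
    using local_angle[OF x] by blast
  have gA: "g (A y) = g (angle y)" if "y \<noteq> 0" for y
    using periodic_eqI[of g, OF assms(1)] A_eq[OF that] by blast
  have "isCont A x" using A has_derivative_continuous by blast
  moreover have "isCont g (A x)"
    using assms(2) by (simp add: continuous_on_eq_continuous_at)
  ultimately have "isCont (\<lambda>y. g (A y)) x" by (rule isCont_o2)
  moreover have "isCont (\<lambda>y. norm y powr (-s)) x"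
    using x by (intro continuous_at_within_powr continuous_norm continuous_ident continuous_const) simp
  ultimately have "isCont (\<lambda>y. norm y powr (-s) * g (A y)) x"
    by (intro isCont_mult)
  moreover have "eventually (\<lambda>y. y \<in> punctured_plane) (nhds x)"
    by (rule eventually_nhds_in_open[OF open_punctured_plane x_in])
  then have "eventually (\<lambda>y. norm y powr (-s) * g (A y) = polar_hom s g y) (nhds x)"
    by (rule eventually_mono) (simp add: polar_hom_def gA)
  then have "isCont (\<lambda>y. norm y powr (-s) * g (A y)) x \<longleftrightarrow> isCont (polar_hom s g) x"
    by (rule isCont_cong)
  ultimately show "isCont (polar_hom s g) x"
    by blast
qed

text \<open>Formulas for \<open>pd\<close> hold on the punctured plane only. Since \<open>S\<close>
  is open, derivatives at its points depend only on values in \<open>S\<close>, at every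
  order.\<close>

lemma C_k_cong:
  assumes "open S" "\<And>x. x \<in> S \<Longrightarrow> f x = g x" "C_k k S f"
  shows "C_k k S g"
  using assms(2,3)
proof (induction k arbitrary: f g)
  case 0
  then show ?case using continuous_on_cong by force
next
  case (Suc k)
  have der: "(g has_derivative frechet_derivative f (at x)) (at x)" if "x \<in> S" for x
    by (rule has_derivative_transform_open[OF _ assms(1) that Suc.prems(1)])
      (use Suc.prems(2) that in \<open>auto simp: frechet_derivative_works[symmetric]\<close>)
  have "pd i f x = pd i g x" if "x \<in> S" for i x
    using pd_eqI[OF der[OF that]] by (simp add: pd_def)
  then have "C_k k S (pd i g)" for i
    using Suc.IH[of "pd i f" "pd i g"] Suc.prems(2) by auto
  then show ?case using der by (auto simp: differentiable_def)
qed

lemma C_k_Suc_imp: "C_k (Suc k) S f \<Longrightarrow> C_k k S f"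
proof (induction k arbitrary: f)
  case 0
  then show ?case
    by (auto intro!: continuous_at_imp_continuous_on differentiable_imp_continuous_within)
next
  case (Suc k)
  then show ?case by (metis C_k.simps(2))
qed

lemma C_k_vec:
  fixes f :: "'n::finite \<Rightarrow> real^2 \<Rightarrow> real"
  assumes "open S" "\<And>j. C_k k S (f j)"
  shows "C_k k S (\<lambda>x. \<chi> j. f j x)"
  using assms(2)
proof (induction k arbitrary: f)
  case 0
  then show ?case by (auto intro: continuous_on_vec_lambda)
next
  case (Suc k)
  have der: "((\<lambda>x. \<chi> j. f j x) has_derivative (\<lambda>h. \<chi> j. frechet_derivative (f j) (at x) h)) (at x)"
    if "x \<in> S" for x
    unfolding has_derivative_componentwise_within[of "\<lambda>x. \<chi> j. f j x"]
  proof
    fix b :: "real^'n" assume "b \<in> Basis"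
    then obtain j where b: "b = axis j 1" by (auto simp: Basis_vec_def)
    have "f j differentiable (at x)" using Suc.prems[of j] that by simp
    then show "((\<lambda>x. (\<chi> j. f j x) \<bullet> b) has_derivative
        (\<lambda>h. (\<chi> j. frechet_derivative (f j) (at x) h) \<bullet> b)) (at x)"
      unfolding b inner_axis frechet_derivative_works by simp
  qed
  have "pd i (\<lambda>x. \<chi> j. f j x) x = (\<chi> j. pd i (f j) x)" if "x \<in> S" for i x
    using pd_eqI[OF der[OF that], of i] by (simp add: pd_def)
  moreover have "C_k k S (\<lambda>x. \<chi> j. pd i (f j) x)" for i
    by (rule Suc.IH) (use Suc.prems in simp)
  ultimately have "C_k k S (pd i (\<lambda>x. \<chi> j. f j x))" for i
    using C_k_cong[OF assms(1), of "\<lambda>x. \<chi> j. pd i (f j) x" "pd i (\<lambda>x. \<chi> j. f j x)" k] by simp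
  moreover have "\<forall>x\<in>S. (\<lambda>x. \<chi> j. f j x) differentiable (at x)"
    using der unfolding differentiable_def by blast
  ultimately show ?case unfolding C_k.simps by blast
qed

text \<open>The angular counterpart of \<open>C_k\<close>. Periodicity is demanded at every level
  because each further Cartesian derivative needs it through
  \<open>has_derivative_polar_hom\<close>.\<close>

primrec periodic_C :: "nat \<Rightarrow> (real \<Rightarrow> real) \<Rightarrow> bool" where
  "periodic_C 0 g \<longleftrightarrow> (\<forall>t. g (t + 2 * pi) = g t) \<and> continuous_on UNIV g"
| "periodic_C (Suc k) g \<longleftrightarrow> (\<forall>t. g (t + 2 * pi) = g t) \<and>
     (\<exists>g'. (\<forall>t. (g has_real_derivative g' t) (at t)) \<and> periodic_C k g')"

lemma periodic_C_imp_periodic: "periodic_C k g \<Longrightarrow> g (t + 2 * pi) = g t"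
  by (cases k) auto

lemma periodic_C_SucI:
  assumes "\<And>t. g (t + 2 * pi) = g t" "\<And>t. (g has_real_derivative g' t) (at t)" "periodic_C k g'"
  shows "periodic_C (Suc k) g"
  using assms by auto

lemma periodic_C_SucE:
  assumes "periodic_C (Suc k) g"
  obtains g' where "\<And>t. (g has_real_derivative g' t) (at t)" "periodic_C k g'"
  using assms unfolding periodic_C.simps by blast

lemma periodic_C_Suc_imp: "periodic_C (Suc k) g \<Longrightarrow> periodic_C k g"
proof (induction k arbitrary: g)
  case 0
  obtain g' where "\<And>t. (g has_real_derivative g' t) (at t)" "periodic_C 0 g'"
    by (rule periodic_C_SucE[OF 0]) (rule that)
  then have "continuous_on UNIV g"
    by (intro continuous_at_imp_continuous_on ballI DERIV_isCont)
  with 0 show ?case unfolding periodic_C.simps by blast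
next
  case (Suc k)
  obtain g' where g': "\<And>t. (g has_real_derivative g' t) (at t)" "periodic_C (Suc k) g'"
    by (rule periodic_C_SucE[OF Suc.prems]) (rule that)
  show ?case
    by (rule periodic_C_SucI[OF periodic_C_imp_periodic[OF Suc.prems] g'(1) Suc.IH[OF g'(2)]])
qed

lemma periodic_C_const: "periodic_C k (\<lambda>_. c)"
proof (induction k arbitrary: c)
  case (Suc k)
  show ?case by (rule periodic_C_SucI[OF _ DERIV_const Suc.IH]) simp
qed simp

lemma periodic_C_add: "periodic_C k f \<Longrightarrow> periodic_C k g \<Longrightarrow> periodic_C k (\<lambda>t. f t + g t)"
proof (induction k arbitrary: f g)
  case 0
  then show ?case by (simp add: continuous_on_add)
next
  case (Suc k)
  obtain f' where f': "\<And>t. (f has_real_derivative f' t) (at t)" "periodic_C k f'"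
    by (rule periodic_C_SucE[OF Suc.prems(1)]) (rule that)
  obtain g' where g': "\<And>t. (g has_real_derivative g' t) (at t)" "periodic_C k g'"
    by (rule periodic_C_SucE[OF Suc.prems(2)]) (rule that)
  show ?case
    by (rule periodic_C_SucI[OF _ DERIV_add[OF f'(1) g'(1)] Suc.IH[OF f'(2) g'(2)]])
      (simp only: periodic_C_imp_periodic[OF Suc.prems(1)] periodic_C_imp_periodic[OF Suc.prems(2)])
qed

lemma periodic_C_mult: "periodic_C k f \<Longrightarrow> periodic_C k g \<Longrightarrow> periodic_C k (\<lambda>t. f t * g t)"
proof (induction k arbitrary: f g)
  case 0
  then show ?case by (simp add: continuous_on_mult)
next
  case (Suc k)
  obtain f' where f': "\<And>t. (f has_real_derivative f' t) (at t)" "periodic_C k f'"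
    by (rule periodic_C_SucE[OF Suc.prems(1)]) (rule that)
  obtain g' where g': "\<And>t. (g has_real_derivative g' t) (at t)" "periodic_C k g'"
    by (rule periodic_C_SucE[OF Suc.prems(2)]) (rule that)
  have d: "periodic_C k (\<lambda>t. f t * g' t + f' t * g t)"
    using Suc.prems[THEN periodic_C_Suc_imp] f'(2) g'(2) by (intro periodic_C_add Suc.IH)
  show ?case
    by (rule periodic_C_SucI[OF _ DERIV_mult'[OF f'(1) g'(1)] d])
      (simp only: periodic_C_imp_periodic[OF Suc.prems(1)] periodic_C_imp_periodic[OF Suc.prems(2)])
qed

lemma periodic_C_sin_cos: "periodic_C k sin" "periodic_C k cos"
proof (induction k)
  case 0
  {
    case 1
    show ?case by (simp add: continuous_on_sin)
  next
    case 2
    show ?case by (simp add: continuous_on_cos)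
  }
next
  case (Suc k)
  {
    case 1
    show ?case by (rule periodic_C_SucI[OF _ DERIV_sin Suc.IH(2)]) simp
  next
    case 2
    have "periodic_C k (\<lambda>t. - 1 * sin t)"
      by (rule periodic_C_mult[OF periodic_C_const Suc.IH(1)])
    then have d: "periodic_C k (\<lambda>t. - sin t)" by simp
    show ?case by (rule periodic_C_SucI[OF _ DERIV_cos d]) simp
  }
qed

lemmas periodic_C_intros = periodic_C_const periodic_C_add periodic_C_mult periodic_C_sin_cos

text \<open>A Cartesian derivative costs one derivative of the profile and raises the exponent by
  one; hence the induction runs over arbitrary \<open>s\<close> and \<open>g\<close>.\<close>

lemma C_k_polar_hom: "periodic_C k g \<Longrightarrow> C_k k punctured_plane (polar_hom s g)"
proof (induction k arbitrary: s g)
  case 0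
  then show ?case by (auto intro: continuous_on_polar_hom)
next
  case (Suc k)
  obtain g' where g': "\<And>t. (g has_real_derivative g' t) (at t)" "periodic_C k g'"
    by (rule periodic_C_SucE[OF Suc.prems]) (rule that)
  note per = periodic_C_imp_periodic[OF Suc.prems]
  have g: "periodic_C k g" using Suc.prems by (rule periodic_C_Suc_imp)
  have "periodic_C k (\<lambda>t. (- s * cos t) * g t + (-1 * sin t) * g' t)"
    "periodic_C k (\<lambda>t. - s * sin t * g t + cos t * g' t)"
    by (intro periodic_C_intros g g')+
  from this[THEN Suc.IH] have C: "C_k k punctured_plane (polar_hom (s + 1) (\<lambda>t. - s * cos t * g t - sin t * g' t))"
    "C_k k punctured_plane (polar_hom (s + 1) (\<lambda>t. - s * sin t * g t + cos t * g' t))"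
    by simp_all
  have "C_k k punctured_plane (pd 1 (polar_hom s g))"
    by (rule C_k_cong[OF open_punctured_plane _ C(1)])
      (simp only: Diff_iff UNIV_I singleton_iff simp_thms pd_polar_hom(1)[of g g', OF per g'(1)])
  moreover have "C_k k punctured_plane (pd 2 (polar_hom s g))"
    by (rule C_k_cong[OF open_punctured_plane _ C(2)])
      (simp only: Diff_iff UNIV_I singleton_iff simp_thms pd_polar_hom(2)[of g g', OF per g'(1)])
  moreover have "polar_hom s g differentiable (at x)" if "x \<noteq> 0" for x
    using has_derivative_polar_hom[of g g', OF per g'(1) that] by (auto simp: differentiable_def)
  ultimately show ?case by (auto simp: forall_2)
qed

section \<open>Scaling and reflection in polar form\<close>

lemma polar_hom_scale:
  assumes "c > 0"
  shows "polar_hom s g (c *\<^sub>R x) = c powr (- s) * polar_hom s g x"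
proof -
  have "Complex (c * x $ 1) (c * x $ 2) = of_real c * Complex (x $ 1) (x $ 2)"
    by (simp add: complex_eq_iff)
  then have "angle (c *\<^sub>R x) = angle x"
    using assms by simp
  then show ?thesis using assms by (simp add: polar_hom_def powr_mult)
qed

lemma norm_reflect: "norm (reflect x) = norm x"
  by (simp add: norm_vec_def L2_set_def sum_2 reflect_def)

text \<open>Reflection negates the angle only modulo \<open>2 * pi\<close>: on the negative
  half-axis the principal angle \<open>pi\<close> stays \<open>pi\<close>. Periodicity of
  \<open>g\<close> absorbs this.\<close>

lemma polar_hom_reflect:
  assumes "\<And>t. g (t + 2 * pi) = g t" "x \<noteq> 0"
  shows "polar_hom s g (reflect x) = polar_hom s (\<lambda>t. g (- t)) x"
proof -
  have "reflect x \<noteq> 0" using assms(2) norm_reflect by (metis norm_eq_zero)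
  from cos_sin_angle[OF this] cos_sin_angle[OF assms(2)]
  have "cos (angle (reflect x)) = cos (- angle x)" "sin (angle (reflect x)) = sin (- angle x)"
    unfolding norm_reflect cos_minus sin_minus by (simp_all add: reflect_def)
  then have "g (angle (reflect x)) = g (- angle x)"
    by (rule periodic_eqI[of g, OF assms(1)])
  then show ?thesis by (simp add: polar_hom_def norm_reflect)
qed

subsection \<open>Level sets\<close>

text \<open>A common model for nonzero levels: it depends on the sign of \<open>C\<close> alone, not
  on the stream function, so two stream functions can be compared through it.\<close>

definition "half_circle C = {x :: real^2. norm x = 1 \<and> sgn (x $ 2) = sgn (C::real)}"

text \<open>Oddness and periodicity force zeros of \<open>g\<close> at \<open>0\<close> and
  \<open>pi\<close>, so \<open>g\<close> has the sign of \<open>sin\<close> on the whole range of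
  \<open>Arg\<close>.\<close>

lemma sgn_polar_hom:
  assumes per: "\<And>t. g (t + 2 * pi) = g t" and odd: "\<And>t. g (- t) = - g t"
    and pos: "\<And>t. 0 < t \<Longrightarrow> t < pi \<Longrightarrow> g t > 0" and x: "x \<noteq> 0"
  shows "sgn (polar_hom s g x) = sgn (x $ 2)"
proof -
  have n: "norm x > 0" using x by simp
  have s: "sin (angle x) = x $ 2 / norm x" using cos_sin_angle[OF x] by simp
  define t where "t = angle x"
  have t: "- pi < t" "t \<le> pi" unfolding t_def by (simp_all add: mpi_less_Arg Arg_le_pi)
  have "g 0 = 0" using odd[of 0] by simp
  moreover have "g pi = 0" using odd[of pi] per[of "- pi"] by simp
  ultimately have "sgn (g t) = sgn (sin t)"
    using t pos[of t] pos[of "- t"] odd[of t] sin_gt_zero[of t] sin_gt_zero[of "-t"]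
    by (cases "t < 0"; cases "t = 0"; cases "t = pi") auto
  then show ?thesis
    using n s unfolding t_def polar_hom_def
    by (simp add: sgn_mult sgn_divide del: sin_Arg)
qed

text \<open>Along a ray on which the function has the sign of \<open>C\<close>, it is a nonzero
  multiple of \<open>r powr (- s)\<close> and takes the value \<open>C\<close> exactly once. On all
  other rays it never does.\<close>

lemma level_set_polar_hom_homeomorphic:
  assumes per: "\<And>t. g (t + 2 * pi) = g t" and odd: "\<And>t. g (- t) = - g t"
    and pos: "\<And>t. 0 < t \<Longrightarrow> t < pi \<Longrightarrow> g t > 0" and cont: "continuous_on UNIV g"
    and s: "s > 0" and C: "C \<noteq> 0"
  shows "level_set (polar_hom s g) C homeomorphic half_circle C"
proof -
  let ?\<psi> = "polar_hom s g"
  note sgn = sgn_polar_hom[of g, OF per odd pos]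
  have co: "continuous_on punctured_plane ?\<psi>"
    by (rule continuous_on_polar_hom[OF per cont])
  define f where "f x = (1 / norm x) *\<^sub>R x" for x :: "real^2"
  \<comment> \<open>The equation \<open>?\<psi> (c *\<^sub>R x) = C\<close> reads
    \<open>c powr (- s) * ?\<psi> x = C\<close> by homogeneity; solving for \<open>c\<close> gives
    this factor.\<close>
  define h where "h x = ((?\<psi> x / C) powr (1 / s)) *\<^sub>R x" for x :: "real^2"
  have pos_ratio: "?\<psi> x / C > 0" if "x \<in> half_circle C" for x
  proof -
    have "x \<noteq> 0" using that by (auto simp: half_circle_def)
    then have "sgn (?\<psi> x) = sgn C" using sgn[of x s] that by (simp add: half_circle_def)
    moreover have "sgn C \<noteq> 0" using C by (simp only: sgn_zero_iff not_False_eq_True)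
    ultimately have "sgn (?\<psi> x / C) = 1" by (simp add: sgn_divide)
    then show ?thesis by (simp only: sgn_1_pos)
  qed
  have fh: "f x \<in> half_circle C \<and> h (f x) = x" if "x \<in> level_set ?\<psi> C" for x
  proof -
    have x: "x \<noteq> 0" "?\<psi> x = C" using that by (auto simp: level_set_def)
    have n: "norm x > 0" using x by simp
    have "sgn (x $ 2) = sgn C" using sgn[of x s] x by simp
    then have "f x \<in> half_circle C"
      using n by (simp add: half_circle_def f_def sgn_divide)
    moreover have "?\<psi> (f x) = norm x powr s * C"
      using n x(2) polar_hom_scale[of "1 / norm x" s g x]
      by (simp add: f_def powr_minus powr_divide)
    then have "(?\<psi> (f x) / C) powr (1 / s) = norm x"
      using C s n by (simp add: powr_powr)
    ultimately show ?thesis using n by (simp add: h_def) (simp add: f_def)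
  qed
  have hf: "h x \<in> level_set ?\<psi> C \<and> f (h x) = x" if "x \<in> half_circle C" for x
  proof -
    let ?c = "(?\<psi> x / C) powr (1 / s)"
    have c: "?c > 0" using pos_ratio[OF that] by (metis powr_gt_zero less_irrefl)
    have x: "x \<noteq> 0" "norm x = 1" using that by (auto simp: half_circle_def)
    have "?\<psi> (h x) = ?c powr (- s) * ?\<psi> x"
      unfolding h_def using c by (rule polar_hom_scale)
    also have "?c powr (- s) = (?\<psi> x / C) powr (-1)"
      using s by (simp add: powr_powr)
    also have "\<dots> = inverse (?\<psi> x / C)"
      unfolding powr_minus powr_one[OF less_imp_le[OF pos_ratio[OF that]]] ..
    also have "\<dots> * ?\<psi> x = C"
    proof -
      have "?\<psi> x \<noteq> 0" using pos_ratio[OF that] by auto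
      then show ?thesis by simp
    qed
    finally have "?\<psi> (h x) = C" .
    moreover have "h x \<noteq> 0" using x(1) c by (simp add: h_def)
    moreover have "f (h x) = x" using x c by (simp add: f_def h_def)
    ultimately show ?thesis by (auto simp: level_set_def)
  qed
  have "homeomorphism (level_set ?\<psi> C) (half_circle C) f h"
  proof (rule homeomorphismI)
    show "continuous_on (level_set ?\<psi> C) f"
      unfolding f_def by (intro continuous_intros) (auto simp: level_set_def)
    have "continuous_on (half_circle C) ?\<psi>"
      by (rule continuous_on_subset[OF co]) (auto simp: half_circle_def)
    then show "continuous_on (half_circle C) h"
      unfolding h_def using C pos_ratio by (intro continuous_intros) force+
  qed (use fh hf in auto)
  then show ?thesis unfolding homeomorphic_def by blast
qed

text \<open>Nonzero levels are compared through the half circle. At level \<open>0\<close> both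
  functions vanish exactly on the axis \<open>x $ 2 = 0\<close>, so the two sets are even
  equal.\<close>

lemma level_sets_polar_hom_homeomorphic:
  assumes "\<And>t. f (t + 2 * pi) = f t" "\<And>t. f (- t) = - f t" "\<And>t. 0 < t \<Longrightarrow> t < pi \<Longrightarrow> f t > 0"
    "continuous_on UNIV f" "s > 0"
    and "\<And>t. g (t + 2 * pi) = g t" "\<And>t. g (- t) = - g t" "\<And>t. 0 < t \<Longrightarrow> t < pi \<Longrightarrow> g t > 0"
    "continuous_on UNIV g" "s' > 0"
  shows "level_set (polar_hom s f) C homeomorphic level_set (polar_hom s' g) C"
proof (cases "C = 0")
  case True
  have "polar_hom s f x = 0 \<longleftrightarrow> polar_hom s' g x = 0" if "x \<noteq> 0" for x
    using sgn_polar_hom[of f x s, OF assms(1-3) that] sgn_polar_hom[of g x s', OF assms(6-8) that]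
    by (metis sgn_0_0)
  then have "level_set (polar_hom s f) C = level_set (polar_hom s' g) C"
    using True by (auto simp: level_set_def)
  then show ?thesis by (simp add: homeomorphic_refl)
next
  case False
  have "level_set (polar_hom s f) C homeomorphic half_circle C"
    using assms(1-5) False by (rule level_set_polar_hom_homeomorphic)
  moreover have "level_set (polar_hom s' g) C homeomorphic half_circle C"
    using assms(6-10) False by (rule level_set_polar_hom_homeomorphic)
  ultimately show ?thesis
    using homeomorphic_sym homeomorphic_trans by blast
qed

lemma \<psi>0_eq: "\<psi>0 = polar_hom 1 sin"
  by (simp add: fun_eq_iff \<psi>0_def polar_hom_def powr_minus_divide)

subsection \<open>The angular profile\<close>

text \<open>If \<open>q\<close> is a Caratheodory quotient of \<open>f\<close>, then
  \<open>q * g\<close> is one of \<open>f * g\<close>, because \<open>f x = 0\<close>; thus mere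
  continuity of \<open>g\<close> suffices. This handles the zeros of the profile and its turning
  points.\<close>

lemma DERIV_mult_vanishing:
  fixes f g :: "real \<Rightarrow> real"
  assumes f: "(f has_real_derivative D) (at x)" and 0: "f x = 0" and g: "isCont g x"
  shows "((\<lambda>y. f y * g y) has_real_derivative D * g x) (at x)"
proof -
  obtain q where q: "\<forall>z. f z - f x = q z * (z - x)" "isCont q x" "q x = D"
    using f unfolding CARAT_DERIV by blast
  have "f z * g z - f x * g x = (q z * g z) * (z - x)" for z
    using spec[OF q(1), of z] 0 by (simp del: right_diff_distrib' add: mult_ac)
  then have "\<forall>z. f z * g z - f x * g x = (q z * g z) * (z - x)" ..
  moreover have "isCont (\<lambda>z. q z * g z) x" using q(2) g by (rule isCont_mult)
  ultimately show ?thesis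
    unfolding CARAT_DERIV by (intro exI[of _ "\<lambda>z. q z * g z"]) (simp add: q(3))
qed

section \<open>Even powers and their difference quotient at 1\<close>

lemma continuous_on_sq_powr:
  fixes b :: real assumes "b > 0"
  shows "continuous_on UNIV (\<lambda>x::real. (x\<^sup>2) powr b)"
  by (rule continuous_on_powr') (use assms in \<open>auto intro!: continuous_intros\<close>)

text \<open>Squaring the base turns the power into that of the absolute value with exponent
  \<open>2 * b\<close>, so one formula covers both signs. At \<open>0\<close> the factor
  \<open>x\<close> vanishes and the other is continuous; there the derivative is
  \<open>0 powr b = 0\<close>.\<close>

lemma DERIV_times_sq_powr:
  fixes b :: real assumes "b > 0"
  shows "((\<lambda>x::real. x * (x\<^sup>2) powr b) has_real_derivative (1 + 2 * b) * (x\<^sup>2) powr b) (at x)"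
proof (cases "x = 0")
  case True
  have "isCont (\<lambda>x::real. (x\<^sup>2) powr b) x"
    using continuous_on_sq_powr[OF assms] by (simp add: continuous_on_eq_continuous_at)
  from DERIV_mult_vanishing[OF DERIV_ident True this] show ?thesis
    using True by simp
next
  case False
  then have p: "x\<^sup>2 > 0" by simp
  have "((\<lambda>x::real. (x\<^sup>2) powr b) has_real_derivative (b * (x\<^sup>2) powr (b - 1)) * (2 * x)) (at x)"
    by (rule DERIV_chain2[of "\<lambda>z. z powr b" _ "power2" x, OF has_real_derivative_powr[OF p, of b]])
      (use DERIV_pow[of 2 x] in simp)
  from DERIV_mult'[OF DERIV_ident this]
  have "((\<lambda>x::real. x * (x\<^sup>2) powr b) has_real_derivative
      (x * ((b * (x\<^sup>2) powr (b - 1)) * (2 * x)) + 1 * (x\<^sup>2) powr b)) (at x)" .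
  moreover have "(x\<^sup>2) powr b = x * x * (x\<^sup>2) powr (b - 1)"
  proof -
    have "(x\<^sup>2) powr (b - 1) * (x\<^sup>2) powr 1 = (x\<^sup>2) powr b"
      by (simp only: powr_add[symmetric] diff_add_cancel)
    then show ?thesis using p by (simp add: power2_eq_square algebra_simps)
  qed
  ultimately show ?thesis by (simp add: algebra_simps)
qed

text \<open>The difference quotient of \<open>t powr a\<close> between \<open>t\<close> and
  \<open>1\<close>, with the removable singularity at \<open>1\<close> filled by the derivative
  \<open>a\<close>. At \<open>t = (sin \<theta>)\<^sup>2\<close> the denominator is
  \<open>(cos \<theta>)\<^sup>2\<close>, which vanishes at the turning points.\<close>

definition powr_slope :: "real \<Rightarrow> real \<Rightarrow> real" where
  "powr_slope a t = (if t = 1 then a else (1 - t powr a) / (1 - t))"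

lemma isCont_powr_slope_1: "isCont (powr_slope a) 1"
proof -
  have "((\<lambda>t. t powr a) has_real_derivative a) (at 1)"
    using has_real_derivative_powr[of 1 a] by simp
  then have "(\<lambda>t. (t powr a - 1) / (t - 1)) \<midarrow>1\<rightarrow> a"
    by (simp add: has_field_derivative_iff)
  moreover have "\<forall>\<^sub>F t in at 1. (t powr a - 1) / (t - 1) = powr_slope a t"
    unfolding eventually_at_filter powr_slope_def
    using minus_divide_divide[of "1 - t powr a" "1 - t" for t]
    by (intro always_eventually allI impI) simp
  ultimately have "powr_slope a \<midarrow>1\<rightarrow> a"
    by (rule Lim_transform_eventually)
  then show ?thesis by (simp add: isCont_def powr_slope_def)
qed

lemma isCont_powr_slope_sq:
  assumes "a > 0"
  shows "isCont (\<lambda>s. powr_slope a (s\<^sup>2)) s"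
proof (cases "s\<^sup>2 = 1")
  case True
  have "isCont (powr_slope a) (s\<^sup>2)" unfolding True by (rule isCont_powr_slope_1)
  then show ?thesis by (rule isCont_o2[OF isCont_power[OF continuous_ident]])
next
  case False
  have "isCont (\<lambda>s. (s\<^sup>2) powr a) s"
    using continuous_on_sq_powr[OF assms] by (simp add: continuous_on_eq_continuous_at)
  then have c: "isCont (\<lambda>s. (1 - (s\<^sup>2) powr a) / (1 - s\<^sup>2)) s"
    using False
    by (intro isCont_divide isCont_diff isCont_power continuous_ident continuous_const) auto
  have "open {s::real. s\<^sup>2 \<noteq> 1}"
    by (intro open_Collect_neq continuous_intros)
  then have "\<forall>\<^sub>F s in nhds s. s \<in> {s. s\<^sup>2 \<noteq> 1}"
    using False by (intro eventually_nhds_in_open) simp_all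
  then have "\<forall>\<^sub>F s in nhds s. (1 - (s\<^sup>2) powr a) / (1 - s\<^sup>2) = powr_slope a (s\<^sup>2)"
    by (rule eventually_mono) (simp add: powr_slope_def)
  from isCont_cong[OF this] c show ?thesis by blast
qed

text \<open>On the unit interval \<open>t powr a \<le> t\<close>. The bound keeps \<open>V\<close>
  positive and makes the half-period at most \<open>pi\<close> for large enough
  \<open>k\<close>.\<close>

lemma powr_slope_ge_1:
  assumes "a \<ge> 1" "0 \<le> t" "t \<le> 1"
  shows "powr_slope a t \<ge> 1"
proof (cases "t = 1")
  case False
  have "t powr a \<le> t powr 1" using assms by (intro powr_mono') auto
  then have "t powr a \<le> t" using assms by simp
  then show ?thesis using False assms by (simp add: powr_slope_def)
qed (use assms in \<open>simp add: powr_slope_def\<close>)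

text \<open>Separation of variables: \<open>\<Theta>\<close> is the inverse of the antiderivative
  \<open>\<Phi>\<close> of \<open>m\<close> with \<open>\<Phi> 0 = 0\<close>. The symmetries of
  \<open>m\<close> and its integral over a period pass to \<open>\<Phi>\<close>, and from there to
  the inverse.\<close>

lemma ex_phase:
  fixes m :: "real \<Rightarrow> real"
  assumes cont: "\<And>x. isCont m x" and pos: "\<And>x. m x > 0"
    and even: "\<And>x. m (- x) = m x" and per: "\<And>x. m (x + pi) = m x"
    and int: "integral {0..pi} m = pi"
  obtains \<Theta> where "\<And>t. (\<Theta> has_real_derivative 1 / m (\<Theta> t)) (at t)"
    "\<And>t. \<Theta> (- t) = - \<Theta> t" "\<And>t. \<Theta> (t + pi) = \<Theta> t + pi"
    "\<And>t. 0 < t \<Longrightarrow> t < pi \<Longrightarrow> 0 < \<Theta> t \<and> \<Theta> t < pi"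
proof -
  obtain F where F: "\<And>x::real. (F has_vector_derivative m x) (at x)"
    using einterval_antiderivative[of "-\<infinity>" "\<infinity>" m] cont by auto
  define \<Phi> where "\<Phi> x = F x - F 0" for x
  have d\<Phi>: "(\<Phi> has_real_derivative m x) (at x)" for x
    using F[of x] unfolding \<Phi>_def has_real_derivative_iff_has_vector_derivative
    by (auto intro!: derivative_eq_intros)
  have "\<Phi> 0 = 0" by (simp add: \<Phi>_def)
  have mono: "strict_mono \<Phi>"
  proof (rule strict_monoI)
    fix x y :: real assume "x < y"
    then show "\<Phi> x < \<Phi> y"
      by (rule DERIV_pos_imp_increasing) (use d\<Phi> pos in blast)
  qed
  have "(m has_integral (\<Phi> pi - \<Phi> 0)) {0..pi}"
    using d\<Phi> by (intro fundamental_theorem_of_calculus)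
      (auto simp: has_real_derivative_iff_has_vector_derivative intro: has_vector_derivative_at_within)
  then have \<Phi>pi: "\<Phi> pi = pi"
    using int \<open>\<Phi> 0 = 0\<close> by (simp add: integral_unique)
  have odd: "\<Phi> (- x) = - \<Phi> x" for x
  proof -
    have "((\<lambda>x. \<Phi> x + \<Phi> (- x)) has_real_derivative m x + m (- x) * (- 1)) (at x)" for x
      by (rule DERIV_add[OF d\<Phi> DERIV_chain2[of \<Phi> _ uminus, OF d\<Phi> DERIV_minus[OF DERIV_ident]]])
    then have "\<forall>x. ((\<lambda>x. \<Phi> x + \<Phi> (- x)) has_real_derivative 0) (at x)"
      using even by simp
    from DERIV_isconst_all[OF this, of x 0] show ?thesis using \<open>\<Phi> 0 = 0\<close> by simp
  qed
  have shift: "\<Phi> (x + pi) = \<Phi> x + pi" for x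
  proof -
    have "((\<lambda>x. \<Phi> (x + pi) - \<Phi> x) has_real_derivative m (x + pi) * 1 - m x) (at x)" for x
      by (rule DERIV_diff[OF DERIV_chain2[of \<Phi> _ "\<lambda>x. x + pi", OF d\<Phi>] d\<Phi>])
        (use DERIV_add[OF DERIV_ident DERIV_const] in simp)
    then have "\<forall>x. ((\<lambda>x. \<Phi> (x + pi) - \<Phi> x) has_real_derivative 0) (at x)"
      using per by simp
    from DERIV_isconst_all[OF this, of x 0] show ?thesis using \<open>\<Phi> 0 = 0\<close> \<Phi>pi by simp
  qed
  have mult: "\<Phi> (real n * pi) = real n * pi" for n
  proof (induction n)
    case (Suc n)
    have "\<Phi> (real (Suc n) * pi) = \<Phi> (real n * pi + pi)" by (simp add: algebra_simps)
    also have "\<dots> = real n * pi + pi" by (simp only: shift Suc)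
    finally show ?case by (simp add: algebra_simps)
  qed (simp add: \<open>\<Phi> 0 = 0\<close>)
  \<comment> \<open>\<open>\<Phi>\<close> agrees with the identity at all multiples of
    \<open>pi\<close>, so it is unbounded in both directions and the intermediate value theorem
    applies.\<close>
  have "\<exists>x. \<Phi> x = y" for y
  proof -
    obtain n where "\<bar>y\<bar> < real n * pi"
      using reals_Archimedean3[OF pi_gt_zero] by blast
    moreover have "continuous_on {- (real n * pi)..real n * pi} \<Phi>"
      using d\<Phi> by (intro continuous_at_imp_continuous_on ballI DERIV_isCont)
    ultimately have "\<exists>x\<ge>- (real n * pi). x \<le> real n * pi \<and> \<Phi> x = y"
      by (intro IVT') (auto simp: odd mult)
    then show ?thesis by blast
  qed
  then have "bij \<Phi>"
    unfolding bij_def surj_def using mono by (auto simp: strict_mono_imp_inj_on intro: sym)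
  define \<Theta> where "\<Theta> = inv \<Phi>"
  have \<Theta>: "\<Theta> (\<Phi> x) = x" "\<Phi> (\<Theta> y) = y" for x y
    using \<open>bij \<Phi>\<close> by (simp_all add: \<Theta>_def bij_is_inj bij_is_surj surj_f_inv_f)
  show thesis
  proof (rule that)
    show "(\<Theta> has_real_derivative 1 / m (\<Theta> t)) (at t)" for t
      unfolding has_field_derivative_def
    proof (rule has_derivative_inverse_strong_x[of UNIV \<Theta> t \<Phi> "(*) (m (\<Theta> t))"])
      show "continuous_on UNIV \<Phi>"
        using d\<Phi> by (intro continuous_at_imp_continuous_on ballI DERIV_isCont)
      show "(\<Phi> has_derivative (*) (m (\<Theta> t))) (at (\<Theta> t))"
        using d\<Phi> by (simp add: has_field_derivative_def)
      show "(*) (m (\<Theta> t)) \<circ> (*) (1 / m (\<Theta> t)) = id"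
        using pos[of "\<Theta> t"] by (auto simp: fun_eq_iff)
    qed (simp_all add: \<Theta>)
    show "\<Theta> (- t) = - \<Theta> t" for t
      using \<Theta>(1)[of "- \<Theta> t"] by (simp add: odd \<Theta>)
    show "\<Theta> (t + pi) = \<Theta> t + pi" for t
      using \<Theta>(1)[of "\<Theta> t + pi"] by (simp add: shift \<Theta>)
    show "0 < \<Theta> t \<and> \<Theta> t < pi" if "0 < t" "t < pi" for t
      using that strict_mono_less[OF mono, of 0 "\<Theta> t"] strict_mono_less[OF mono, of "\<Theta> t" pi]
      by (simp add: \<Theta> \<open>\<Phi> 0 = 0\<close> \<Phi>pi)
  qed
qed

lemma odd_deriv:
  fixes g :: "real \<Rightarrow> real"
  assumes odd: "\<And>t. g (- t) = - g t" and dg: "\<And>t. (g has_real_derivative g' t) (at t)"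
  shows "g' (- t) = g' t"
proof -
  have "((\<lambda>t. g (- t)) has_real_derivative g' (- t) * - 1) (at t)"
    by (rule DERIV_chain2[of g _ uminus, OF dg DERIV_minus[OF DERIV_ident]])
  moreover have "((\<lambda>t. g (- t)) has_real_derivative - g' t) (at t)"
    unfolding odd by (rule DERIV_minus[OF dg])
  ultimately have "g' (- t) * - 1 = - g' t" by (rule DERIV_unique)
  then show ?thesis by simp
qed

text \<open>The third conclusion is the first integral of the second-order equation: differentiating
  it and dividing by \<open>2 * v\<close> explains the factor \<open>k * (1 + 1 / \<beta>)\<close>.
  Positivity of \<open>k\<close> is recorded because it makes the flow rotational.\<close>

lemma ex_profile:
  fixes \<beta> :: real
  assumes "0 < \<beta>" "\<beta> < 1"
  obtains w v :: "real \<Rightarrow> real" and k :: real where "k > 0"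
    "\<And>t. (w has_real_derivative v t) (at t)"
    "\<And>t. (v has_real_derivative
       - \<beta>\<^sup>2 * w t - k * (1 + 1 / \<beta>) * (w t * ((w t)\<^sup>2) powr (1 / \<beta>))) (at t)"
    "\<And>t. (v t)\<^sup>2 = \<beta>\<^sup>2 * (1 - (w t)\<^sup>2) + k * (1 - (w t)\<^sup>2 * ((w t)\<^sup>2) powr (1 / \<beta>))"
    "\<And>t. w (- t) = - w t" "\<And>t. w (t + pi) = - w t" "\<And>t. 0 < t \<Longrightarrow> t < pi \<Longrightarrow> w t > 0"
proof -
  define b where "b = 1 / \<beta>"
  have b: "b > 0" using assms by (simp add: b_def)
  define P where "P s = (s\<^sup>2) powr b" for s :: real
  \<comment> \<open>With \<open>w = sin \<theta>\<close> the energy identity reads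
    \<open>v\<^sup>2 = (cos \<theta>)\<^sup>2 * V k \<theta>\<close>; \<open>H\<close> is what
    remains of the power term after division by \<open>(cos \<theta>)\<^sup>2\<close>.\<close>
  define H where "H \<theta> = powr_slope (b + 1) ((sin \<theta>)\<^sup>2)" for \<theta> :: real
  define V where "V k \<theta> = \<beta>\<^sup>2 + k * H \<theta>" for k \<theta>
  have P: "(s\<^sup>2) powr (b + 1) = s * (s * P s)" for s
  proof (cases "s = 0")
    case False
    then show ?thesis by (simp add: P_def powr_add power2_eq_square)
  qed simp
  have H_cont: "isCont H \<theta>" for \<theta>
    unfolding H_def by (rule isCont_o2[OF isCont_sin isCont_powr_slope_sq])
      (use b in simp)
  have H_ge: "H \<theta> \<ge> 1" for \<theta>
    unfolding H_def by (rule powr_slope_ge_1) (use b abs_sin_le_one[of \<theta>] in \<open>simp_all add: abs_square_le_1\<close>)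
  have \<beta>2: "0 < \<beta>\<^sup>2" "\<beta>\<^sup>2 < 1" using assms by (simp_all add: power_less_one_iff)
  have V_pos: "V k \<theta> > 0" if "k \<ge> 0" for k \<theta>
    unfolding V_def using \<beta>2(1) mult_nonneg_nonneg[OF that, of "H \<theta>"] H_ge[of \<theta>] by linarith
  define T where "T k = integral {0..pi} (\<lambda>\<theta>. 1 / sqrt (V k \<theta>))" for k
  have "continuous_on {0..1 - \<beta>\<^sup>2} (\<lambda>k. integral (cbox 0 pi) (\<lambda>\<theta>. 1 / sqrt (V k \<theta>)))"
  proof (rule integral_continuous_on_param)
    have "continuous_on UNIV H"
      using H_cont by (intro continuous_at_imp_continuous_on ballI)
    then have "continuous_on ({0..1 - \<beta>\<^sup>2} \<times> cbox 0 pi) (\<lambda>z. H (snd z))"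
      by (rule continuous_on_compose2[OF _ continuous_on_snd[OF continuous_on_id]]) simp
    then have "continuous_on ({0..1 - \<beta>\<^sup>2} \<times> cbox 0 pi) (\<lambda>z. sqrt (V (fst z) (snd z)))"
      unfolding V_def
      by (rule continuous_on_real_sqrt[OF continuous_on_add[OF continuous_on_const
              continuous_on_mult[OF continuous_on_fst[OF continuous_on_id]]]])
    then show "continuous_on ({0..1 - \<beta>\<^sup>2} \<times> cbox 0 pi) (\<lambda>(k, \<theta>). 1 / sqrt (V k \<theta>))"
      unfolding case_prod_beta
    proof (rule continuous_on_divide[OF continuous_on_const], intro ballI)
      fix z assume "z \<in> {0..1 - \<beta>\<^sup>2} \<times> cbox 0 pi"
      then have "V (fst z) (snd z) > 0" by (intro V_pos) auto
      then show "sqrt (V (fst z) (snd z)) \<noteq> 0" by simp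
    qed
  qed
  then have T_cont: "continuous_on {0..1 - \<beta>\<^sup>2} T" by (simp add: T_def[abs_def])
  have V_cont': "isCont (V k) \<theta>" for k \<theta>
    unfolding V_def by (rule isCont_add[OF continuous_const isCont_mult[OF continuous_const H_cont]])
  have V_cont: "isCont (\<lambda>\<theta>. 1 / sqrt (V k \<theta>)) \<theta>" if "k \<ge> 0" for k \<theta>
    by (rule isCont_divide[OF continuous_const isCont_o2[OF V_cont' isCont_real_sqrt]])
      (use V_pos[OF that, of \<theta>] in simp)
  have "T 0 = pi / \<beta>" using assms by (simp add: T_def V_def)
  moreover have "pi < pi / \<beta>" using assms by (simp add: less_divide_eq)
  ultimately have T0: "T 0 > pi" by simp
  \<comment> \<open>The endpoint \<open>1 - \<beta>\<^sup>2\<close> is the value of \<open>k\<close>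
    for which \<open>H \<ge> 1\<close> yields \<open>V k \<theta> \<ge> 1\<close>.\<close>
  have "T (1 - \<beta>\<^sup>2) \<le> integral {0..pi} (\<lambda>_. 1)"
    unfolding T_def
  proof (rule integral_le)
    show "(\<lambda>\<theta>. 1 / sqrt (V (1 - \<beta>\<^sup>2) \<theta>)) integrable_on {0..pi}"
      using V_cont \<beta>2 by (intro integrable_continuous_interval continuous_at_imp_continuous_on) simp
    show "1 / sqrt (V (1 - \<beta>\<^sup>2) \<theta>) \<le> 1" for \<theta>
    proof -
      have "(1 - \<beta>\<^sup>2) * 1 \<le> (1 - \<beta>\<^sup>2) * H \<theta>" using H_ge \<beta>2 by (intro mult_left_mono) auto
      then have "V (1 - \<beta>\<^sup>2) \<theta> \<ge> 1"
        by (simp only: V_def diff_le_eq mult_1_right add.commute)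
      then show ?thesis by simp
    qed
  qed (rule integrable_on_const, simp)
  then have T1: "T (1 - \<beta>\<^sup>2) \<le> pi" by simp
  obtain k where k: "0 \<le> k" "T k = pi"
    using IVT2'[of T "1 - \<beta>\<^sup>2" pi 0] T0 T1 T_cont \<beta>2 by auto
  then have k_pos: "k > 0" using T0 by (cases "k = 0") auto
  have sq: "sqrt (V k \<theta>) > 0" "(sqrt (V k \<theta>))\<^sup>2 = V k \<theta>" for \<theta> using V_pos[OF k(1), of \<theta>] by simp_all
  \<comment> \<open>\<open>V k\<close> is even and \<open>pi\<close>-periodic because it depends on
    the angle only through the square of the sine.\<close>
  obtain \<Theta> where \<Theta>: "\<And>t. (\<Theta> has_real_derivative 1 / (1 / sqrt (V k (\<Theta> t)))) (at t)"
    "\<And>t. \<Theta> (- t) = - \<Theta> t" "\<And>t. \<Theta> (t + pi) = \<Theta> t + pi"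
    "\<And>t. 0 < t \<Longrightarrow> t < pi \<Longrightarrow> 0 < \<Theta> t \<and> \<Theta> t < pi"
  proof (rule ex_phase[of "\<lambda>\<theta>. 1 / sqrt (V k \<theta>)"], goal_cases)
    case (1 x)
    show ?case by (rule V_cont[OF k(1)])
  next
    case (2 x)
    show ?case using sq(1) by simp
  next
    case 5
    show ?case using k(2) by (simp add: T_def)
  next
    case (6 \<Theta>)
    show ?case by (rule 6(1)[OF 6(2-5)])
  qed (simp_all add: V_def H_def)
  have d\<Theta>: "(\<Theta> has_real_derivative sqrt (V k (\<Theta> t))) (at t)" for t
    using \<Theta>(1)[of t] by simp
  define f where "f s = - \<beta>\<^sup>2 * s - k * (1 + b) * (s * P s)" for s
  have dP: "((\<lambda>s. s * (s * P s)) has_real_derivative 2 * (1 + b) * (s * P s)) (at s)" for s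
    using DERIV_mult'[OF DERIV_ident DERIV_times_sq_powr[OF b], of s]
    by (simp add: P_def algebra_simps)
  \<comment> \<open>Here \<open>V\<close> is known to be differentiable only away from the turning
    points. Where \<open>cos \<theta> = 0\<close> the vanishing factor makes continuity of
    \<open>V\<close> enough; elsewhere \<open>V\<close> is locally the explicit quotient
    \<open>Q\<close>.\<close>
  have dE: "((\<lambda>\<theta>. cos \<theta> * sqrt (V k \<theta>)) has_real_derivative f (sin \<theta>) / sqrt (V k \<theta>)) (at \<theta>)" for \<theta>
  proof (cases "cos \<theta> = 0")
    case True
    then have s: "(sin \<theta>)\<^sup>2 = 1" using sin_cos_squared_add[of \<theta>] by simp
    have "isCont (\<lambda>\<theta>. sqrt (V k \<theta>)) \<theta>"
      by (rule isCont_o2[OF V_cont' isCont_real_sqrt])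
    from DERIV_mult_vanishing[OF DERIV_cos True this]
    have "((\<lambda>\<theta>. cos \<theta> * sqrt (V k \<theta>)) has_real_derivative - sin \<theta> * sqrt (V k \<theta>)) (at \<theta>)" .
    moreover have "- sin \<theta> * V k \<theta> = f (sin \<theta>)"
      by (simp add: f_def V_def H_def P_def s powr_slope_def algebra_simps)
    then have "- sin \<theta> * sqrt (V k \<theta>) = f (sin \<theta>) / sqrt (V k \<theta>)"
      using sq[of \<theta>] by (simp add: field_simps power2_eq_square)
    ultimately show ?thesis by simp
  next
    case False
    define Q where "Q \<theta> = \<beta>\<^sup>2 + k * ((1 - sin \<theta> * (sin \<theta> * P (sin \<theta>))) / (cos \<theta>)\<^sup>2)" for \<theta>
    have QV: "Q y = V k y" if "cos y \<noteq> 0" for y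
    proof -
      have "1 - (sin y)\<^sup>2 = (cos y)\<^sup>2" "(sin y)\<^sup>2 \<noteq> 1"
        using that sin_squared_eq[of y] by simp_all
      then show ?thesis by (simp add: Q_def V_def H_def powr_slope_def P)
    qed
    have dN: "((\<lambda>\<theta>. 1 - sin \<theta> * (sin \<theta> * P (sin \<theta>))) has_real_derivative
        0 - 2 * (1 + b) * (sin \<theta> * P (sin \<theta>)) * cos \<theta>) (at \<theta>)"
      by (rule DERIV_diff[OF DERIV_const DERIV_chain2[OF dP DERIV_sin]])
    have dc: "((\<lambda>\<theta>. (cos \<theta>)\<^sup>2) has_real_derivative 2 * cos \<theta> * - sin \<theta>) (at \<theta>)"
      using DERIV_mult'[OF DERIV_cos DERIV_cos, of \<theta>] by (simp add: power2_eq_square mult_ac)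
    define D where "D = k * (((0 - 2 * (1 + b) * (sin \<theta> * P (sin \<theta>)) * cos \<theta>) * (cos \<theta>)\<^sup>2
         - (1 - sin \<theta> * (sin \<theta> * P (sin \<theta>))) * (2 * cos \<theta> * - sin \<theta>)) / ((cos \<theta>)\<^sup>2 * (cos \<theta>)\<^sup>2))"
    have dQ: "(Q has_real_derivative 0 + D) (at \<theta>)"
      unfolding Q_def[abs_def] D_def
      by (rule DERIV_add[OF DERIV_const DERIV_cmult[OF DERIV_divide[OF dN dc]]]) (use False in simp)
    have Qpos: "Q \<theta> > 0" using QV[OF False] V_pos[OF k(1)] by simp
    have "((\<lambda>\<theta>. cos \<theta> * sqrt (Q \<theta>)) has_real_derivative
        cos \<theta> * (inverse (sqrt (Q \<theta>)) / 2 * (0 + D)) + - sin \<theta> * sqrt (Q \<theta>)) (at \<theta>)"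
      by (rule DERIV_mult'[OF DERIV_cos DERIV_chain2[OF DERIV_real_sqrt[OF Qpos] dQ]])
    moreover have "cos \<theta> * (inverse (sqrt (Q \<theta>)) / 2 * (0 + D)) + - sin \<theta> * sqrt (Q \<theta>) =
        f (sin \<theta>) / sqrt (V k \<theta>)"
    proof -
      \<comment> \<open>This is the derivative of \<open>(cos \<theta>)\<^sup>2 * Q \<theta> =
        \<beta>\<^sup>2 * (cos \<theta>)\<^sup>2 + k * (1 - sin \<theta> * (sin \<theta> * P (sin
        \<theta>)))\<close>, divided by \<open>2 * cos \<theta>\<close>.\<close>
      have "cos \<theta> * D / 2 - sin \<theta> * Q \<theta> = f (sin \<theta>)"
        using False unfolding D_def Q_def f_def by (simp add: field_simps power2_eq_square)
      then show ?thesis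
        using sq[of \<theta>] QV[OF False] by (simp add: field_simps power2_eq_square)
    qed
    ultimately have "((\<lambda>\<theta>. cos \<theta> * sqrt (Q \<theta>)) has_real_derivative f (sin \<theta>) / sqrt (V k \<theta>)) (at \<theta>)"
      by simp
    moreover have "open {\<theta>::real. cos \<theta> \<noteq> 0}"
      by (intro open_Collect_neq continuous_intros)
    ultimately show ?thesis
      by (rule has_field_derivative_transform_within_open) (use False QV in auto)
  qed
  show thesis
  proof (rule that[of k "\<lambda>t. sin (\<Theta> t)" "\<lambda>t. cos (\<Theta> t) * sqrt (V k (\<Theta> t))"])
    show "k > 0" by (rule k_pos)
    show "((\<lambda>t. sin (\<Theta> t)) has_real_derivative cos (\<Theta> t) * sqrt (V k (\<Theta> t))) (at t)" for t
      by (rule DERIV_chain2[OF DERIV_sin d\<Theta>])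
    have "((\<lambda>t. cos (\<Theta> t) * sqrt (V k (\<Theta> t))) has_real_derivative
       f (sin (\<Theta> t)) / sqrt (V k (\<Theta> t)) * sqrt (V k (\<Theta> t))) (at t)" for t
      by (rule DERIV_chain2[OF dE d\<Theta>])
    then show "((\<lambda>t. cos (\<Theta> t) * sqrt (V k (\<Theta> t))) has_real_derivative
       - \<beta>\<^sup>2 * sin (\<Theta> t) - k * (1 + 1 / \<beta>) * (sin (\<Theta> t) * ((sin (\<Theta> t))\<^sup>2) powr (1 / \<beta>))) (at t)" for t
      using less_imp_neq[OF V_pos[OF k(1)], symmetric] by (simp add: f_def P_def b_def)
    show "(cos (\<Theta> t) * sqrt (V k (\<Theta> t)))\<^sup>2 = \<beta>\<^sup>2 * (1 - (sin (\<Theta> t))\<^sup>2) +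
       k * (1 - (sin (\<Theta> t))\<^sup>2 * ((sin (\<Theta> t))\<^sup>2) powr (1 / \<beta>))" for t
    proof -
      let ?s = "sin (\<Theta> t)"
      have c: "(cos (\<Theta> t))\<^sup>2 = 1 - ?s\<^sup>2" by (rule cos_squared_eq)
      have "(1 - ?s\<^sup>2) * H (\<Theta> t) = 1 - ?s\<^sup>2 * P ?s"
        using P[of ?s] unfolding H_def powr_slope_def P_def by (simp add: power2_eq_square)
      then have "(1 - ?s\<^sup>2) * V k (\<Theta> t) = \<beta>\<^sup>2 * (1 - ?s\<^sup>2) + k * (1 - ?s\<^sup>2 * P ?s)"
        unfolding V_def by algebra
      then show ?thesis unfolding power_mult_distrib sq(2) c P_def b_def .
    qed
  qed (use \<Theta> sin_gt_zero in auto)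
qed

subsection \<open>The Euler flow\<close>

text \<open>The Cartesian momentum equations at angle \<open>t\<close>, with \<open>c = cos t\<close>, \<open>s = sin t\<close>,
  \<open>z = w''\<close> and \<open>N = \<bar>w\<bar> powr (2 + 2 / \<beta>)\<close>; the factor \<open>r powr (- 2 * \<alpha> - 1)\<close> is removed. The
  azimuthal component vanishes identically; the radial one is the energy identity of the profile.\<close>

lemma momentum_balance:
  fixes \<beta> c s w v z N k :: real
  assumes "c\<^sup>2 + s\<^sup>2 = 1" "\<beta> \<noteq> 0"
    and E: "v\<^sup>2 = \<beta>\<^sup>2 * (1 - w\<^sup>2) + k * (1 - N)"
    and z: "w * z = - \<beta>\<^sup>2 * w\<^sup>2 - k * (1 + 1 / \<beta>) * N"
  defines "g1 \<equiv> c * v + - \<beta> * (s * w)" and "g2 \<equiv> s * v + \<beta> * (c * w)"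
  defines "g1' \<equiv> c * z - \<beta> * (c * w) - (\<beta> + 1) * (s * v)"
    and "g2' \<equiv> s * z - \<beta> * (s * w) + (\<beta> + 1) * (c * v)"
  shows "g1 * (- (\<beta> + 1) * c * g1 - s * g1') + g2 * (- (\<beta> + 1) * s * g1 + c * g1')
      + (\<beta> + 1) * c * (\<beta>\<^sup>2 + k) = 0"
    and "g1 * (- (\<beta> + 1) * c * g2 - s * g2') + g2 * (- (\<beta> + 1) * s * g2 + c * g2')
      + (\<beta> + 1) * s * (\<beta>\<^sup>2 + k) = 0"
proof -
  have bz: "\<beta> * (w * z) = - (\<beta>^3) * w\<^sup>2 - k * (\<beta> + 1) * N"
    unfolding z using \<open>\<beta> \<noteq> 0\<close> by (simp add: field_simps power2_eq_square power3_eq_cube)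
  \<comment> \<open>The radial momentum equation: radial advection, azimuthal advection, the
    centripetal term and the radial pressure derivative, in this order.\<close>
  have radial: "- (\<beta> + 1) * v\<^sup>2 + \<beta> * (w * z) - \<beta>\<^sup>2 * w\<^sup>2 + (\<beta> + 1) * (\<beta>\<^sup>2 + k) = 0"
    unfolding bz E by (simp add: algebra_simps power2_eq_square power3_eq_cube)
  \<comment> \<open>The profiles of the radial and azimuthal velocity. In these terms each Cartesian
    equation becomes \<open>c\<close> or \<open>s\<close> times the radial one.\<close>
  have r: "c * g1 + s * g2 = v" and a: "c * g2 - s * g1 = \<beta> * w"
    using assms(1) unfolding g1_def g2_def by algebra+
  have "g1 * (- (\<beta> + 1) * c * g1 - s * g1') + g2 * (- (\<beta> + 1) * s * g1 + c * g1') =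
      - (\<beta> + 1) * g1 * (c * g1 + s * g2) + (c * g2 - s * g1) * g1'"
    by (simp add: algebra_simps)
  also have "\<dots> + (\<beta> + 1) * c * (\<beta>\<^sup>2 + k) = c * (- (\<beta> + 1) * v\<^sup>2 + \<beta> * (w * z) - \<beta>\<^sup>2 * w\<^sup>2 + (\<beta> + 1) * (\<beta>\<^sup>2 + k))"
    unfolding r a unfolding g1_def g1'_def by (simp add: algebra_simps power2_eq_square)
  finally show "g1 * (- (\<beta> + 1) * c * g1 - s * g1') + g2 * (- (\<beta> + 1) * s * g1 + c * g1')
      + (\<beta> + 1) * c * (\<beta>\<^sup>2 + k) = 0" unfolding radial by simp
  have "g1 * (- (\<beta> + 1) * c * g2 - s * g2') + g2 * (- (\<beta> + 1) * s * g2 + c * g2') =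
      - (\<beta> + 1) * g2 * (c * g1 + s * g2) + (c * g2 - s * g1) * g2'"
    by (simp add: algebra_simps)
  also have "\<dots> + (\<beta> + 1) * s * (\<beta>\<^sup>2 + k) = s * (- (\<beta> + 1) * v\<^sup>2 + \<beta> * (w * z) - \<beta>\<^sup>2 * w\<^sup>2 + (\<beta> + 1) * (\<beta>\<^sup>2 + k))"
    unfolding r a unfolding g2_def g2'_def by (simp add: algebra_simps power2_eq_square)
  finally show "g1 * (- (\<beta> + 1) * c * g2 - s * g2') + g2 * (- (\<beta> + 1) * s * g2 + c * g2')
      + (\<beta> + 1) * s * (\<beta>\<^sup>2 + k) = 0" unfolding radial by simp
qed

theorem theorem1p8:
  fixes \<alpha> :: real
  assumes "1 < \<alpha>" and "\<alpha> < 2"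
  shows "\<exists>(u :: real^2 \<Rightarrow> real^2) (p :: real^2 \<Rightarrow> real) (\<psi> :: real^2 \<Rightarrow> real).
           C_k 2 punctured_plane u \<and>
           euler_solution u p \<and>
           neg_homogeneous \<alpha> u p \<and>
           reflection_symmetric u p \<and>
           rotational u \<and>
           stream_function \<alpha> u \<psi> \<and>
           (\<forall>C. level_set \<psi> C homeomorphic level_set \<psi>0 C)"
proof -
  define \<beta> where "\<beta> = \<alpha> - 1"
  have \<beta>: "0 < \<beta>" "\<beta> < 1" and \<alpha>: "\<alpha> = \<beta> + 1" using assms by (simp_all add: \<beta>_def)
  obtain w v k where k: "k > 0"
    and dw: "\<And>t. (w has_real_derivative v t) (at t)"
    and dv': "\<And>t. (v has_real_derivative
       - \<beta>\<^sup>2 * w t - k * (1 + 1 / \<beta>) * (w t * ((w t)\<^sup>2) powr (1 / \<beta>))) (at t)"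
    and energy: "\<And>t. (v t)\<^sup>2 = \<beta>\<^sup>2 * (1 - (w t)\<^sup>2) + k * (1 - (w t)\<^sup>2 * ((w t)\<^sup>2) powr (1 / \<beta>))"
    and w_odd: "\<And>t. w (- t) = - w t" and w_shift: "\<And>t. w (t + pi) = - w t"
    and w_pos: "\<And>t. 0 < t \<Longrightarrow> t < pi \<Longrightarrow> w t > 0"
    by (rule ex_profile[OF \<beta>]) (rule that)
  define M where "M s = (s\<^sup>2) powr (1 / \<beta>)" for s :: real
  define z where "z t = - \<beta>\<^sup>2 * w t - k * (1 + 1 / \<beta>) * (w t * M (w t))" for t
  define z' where "z' t = - \<beta>\<^sup>2 * v t - k * (1 + 1 / \<beta>) * ((1 + 2 * (1 / \<beta>)) * M (w t) * v t)" for t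
  have dv: "(v has_real_derivative z t) (at t)" for t
    using dv' unfolding z_def M_def .
  have dz: "(z has_real_derivative z' t) (at t)" for t
    unfolding z_def[abs_def] z'_def M_def using \<beta>
    by (intro DERIV_diff DERIV_cmult dw DERIV_chain2[OF DERIV_times_sq_powr dw]) simp
  have w_per: "w (t + 2 * pi) = w t" for t
    using w_shift[of "t + pi"] w_shift[of t] by (simp add: algebra_simps)
  have v_per: "v (t + 2 * pi) = v t" for t by (rule periodic_deriv[OF w_per dw])
  have z_per: "z (t + 2 * pi) = z t" for t by (rule periodic_deriv[OF v_per dv])
  have z'_per: "z' (t + 2 * pi) = z' t" for t by (rule periodic_deriv[OF z_per dz])
  have v_even: "v (- t) = v t" for t by (rule odd_deriv[OF w_odd dw])
  have w_cont: "continuous_on UNIV w"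
    using dw by (intro continuous_at_imp_continuous_on ballI DERIV_isCont)
  have v_cont: "continuous_on UNIV v"
    using dv by (intro continuous_at_imp_continuous_on ballI DERIV_isCont)
  have "continuous_on UNIV (\<lambda>t. M (w t))"
    unfolding M_def using \<beta> by (intro continuous_on_compose2[OF continuous_on_sq_powr w_cont]) auto
  then have "continuous_on UNIV z'"
    unfolding z'_def[abs_def]
    by (intro continuous_on_diff continuous_on_mult continuous_on_const v_cont)
  \<comment> \<open>Since \<open>w * M w\<close> is continuously differentiable even at the zeros of
    \<open>w\<close>, the profile has three continuous derivatives; one is spent in passing from the
    stream function to the velocity.\<close>
  then have "periodic_C 0 z'" using z'_per by simp
  then have "periodic_C (Suc 0) z" by (rule periodic_C_SucI[OF z_per dz])
  then have v_C: "periodic_C (Suc (Suc 0)) v" by (rule periodic_C_SucI[OF v_per dv])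
  then have "periodic_C (Suc (Suc (Suc 0))) w" by (rule periodic_C_SucI[OF w_per dw])
  then have w_C: "periodic_C (Suc (Suc 0)) w" by (rule periodic_C_Suc_imp)
  \<comment> \<open>\<open>g1\<close> and \<open>g2\<close> are the profiles of the x2-derivative of
    the stream function and of minus its x1-derivative, as given by
    \<open>pd_polar_hom\<close>.\<close>
  define g1 where "g1 t = cos t * v t + - \<beta> * (sin t * w t)" for t
  define g2 where "g2 t = sin t * v t + \<beta> * (cos t * w t)" for t
  define g1' where "g1' t = cos t * z t - \<beta> * (cos t * w t) - (\<beta> + 1) * (sin t * v t)" for t
  define g2' where "g2' t = sin t * z t - \<beta> * (sin t * w t) + (\<beta> + 1) * (cos t * v t)" for t
  have dg1: "(g1 has_real_derivative g1' t) (at t)" for t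
    using DERIV_add[OF DERIV_mult'[OF DERIV_cos dv] DERIV_cmult[OF DERIV_mult'[OF DERIV_sin dw]], of "-\<beta>" t]
    by (simp add: g1_def[abs_def] g1'_def algebra_simps)
  have dg2: "(g2 has_real_derivative g2' t) (at t)" for t
    using DERIV_add[OF DERIV_mult'[OF DERIV_sin dv] DERIV_cmult[OF DERIV_mult'[OF DERIV_cos dw]], of \<beta> t]
    by (simp add: g2_def[abs_def] g2'_def algebra_simps)
  have g_C: "periodic_C (Suc (Suc 0)) g1" "periodic_C (Suc (Suc 0)) g2"
    unfolding g1_def[abs_def] g2_def[abs_def] by (intro periodic_C_intros v_C w_C)+
  note g1_per = periodic_C_imp_periodic[OF g_C(1)] and g2_per = periodic_C_imp_periodic[OF g_C(2)]
  \<comment> \<open>With this constant, half the squared speed plus the pressure equals \<open>- (k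
    / 2) * \<bar>\<psi> x\<bar> powr (2 * \<alpha> / \<beta>)\<close>, which is constant along
    streamlines as Bernoulli's law demands.\<close>
  define P where "P = - (\<beta>\<^sup>2 + k) / 2"
  define u :: "real^2 \<Rightarrow> real^2"
    where "u x = (\<chi> j. polar_hom \<alpha> (if j = 1 then g1 else g2) x)" for x
  define p where "p = polar_hom (2 * \<alpha>) (\<lambda>_. P)"
  define \<psi> where "\<psi> = polar_hom \<beta> w"
  have u1: "(\<lambda>x. u x $ 1) = polar_hom \<alpha> g1" and u2: "(\<lambda>x. u x $ 2) = polar_hom \<alpha> g2"
    by (simp_all add: u_def fun_eq_iff)
  note pd_g1 = pd_polar_hom[of g1 g1', OF g1_per dg1]
    and pd_g2 = pd_polar_hom[of g2 g2', OF g2_per dg2]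
    and pd_w = pd_polar_hom[of w v, OF w_per dw]
    and pd_P = pd_polar_hom[of "\<lambda>_. P" "\<lambda>_. 0", OF refl DERIV_const]
  have u_C: "C_k (Suc (Suc 0)) punctured_plane u"
    unfolding u_def by (rule C_k_vec[OF open_punctured_plane]) (intro C_k_polar_hom, use g_C in simp)
  have p_C: "C_k (Suc 0) punctured_plane p"
    unfolding p_def by (rule C_k_polar_hom[OF periodic_C_const])
  have momentum: "u x $ 1 * pd 1 (polar_hom \<alpha> g) x + u x $ 2 * pd 2 (polar_hom \<alpha> g) x + pd i p x = 0"
    if "x \<noteq> 0" "g = g1 \<and> i = 1 \<or> g = g2 \<and> i = 2" for x g i
  proof -
    define t where "t = angle x"
    define R where "R = norm x powr (- (2 * \<alpha> + 1))"
    have R: "norm x powr (- \<alpha>) * norm x powr (- (\<alpha> + 1)) = R"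
      by (simp add: R_def powr_add[symmetric])
    have wz: "w t * z t = - \<beta>\<^sup>2 * (w t)\<^sup>2 - k * (1 + 1 / \<beta>) * ((w t)\<^sup>2 * M (w t))"
      unfolding z_def by (simp add: algebra_simps power2_eq_square)
    have cs: "(cos t)\<^sup>2 + (sin t)\<^sup>2 = 1" by simp
    have "\<beta> \<noteq> 0" using \<beta> by simp
    note bal = momentum_balance[OF cs \<open>\<beta> \<noteq> 0\<close> energy[of t, folded M_def] wz,
        folded g1_def g2_def g1'_def g2'_def]
    have P2: "- (2 * \<alpha>) * y * P - y' * 0 = (\<beta> + 1) * y * (\<beta>\<^sup>2 + k)"
      "- (2 * \<alpha>) * y * P + y' * 0 = (\<beta> + 1) * y * (\<beta>\<^sup>2 + k)" for y y'
      by (simp_all add: P_def \<alpha> field_simps)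
    \<comment> \<open>Advection and pressure gradient carry the same power \<open>R\<close> of the
      radius; taking it out leaves exactly the two identities of
      \<open>momentum_balance\<close>.\<close>
    have fac: "(r * a) * (r' * b) + (r * a') * (r' * b') + R * d = R * (a * b + a' * b' + d)"
      if "r * r' = R" for r r' a b a' b' d
      unfolding that[symmetric] by (simp add: algebra_simps)
    show ?thesis
      using that(2)
    proof
      assume gi: "g = g1 \<and> i = 1"
      have "u x $ 1 * pd 1 (polar_hom \<alpha> g) x + u x $ 2 * pd 2 (polar_hom \<alpha> g) x + pd i p x =
        R * (g1 t * (- (\<beta> + 1) * cos t * g1 t - sin t * g1' t) + g2 t * (- (\<beta> + 1) * sin t * g1 t + cos t * g1' t)
          + (\<beta> + 1) * cos t * (\<beta>\<^sup>2 + k))"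
        unfolding gi[THEN conjunct1] gi[THEN conjunct2] fun_cong[OF u1] fun_cong[OF u2] p_def
          pd_g1[OF that(1)] pd_P[OF that(1)]
        unfolding polar_hom_def t_def[symmetric] P2 R_def[symmetric] fac[OF R] unfolding \<alpha> ..
      then show ?thesis using bal(1) by simp
    next
      assume gi: "g = g2 \<and> i = 2"
      have "u x $ 1 * pd 1 (polar_hom \<alpha> g) x + u x $ 2 * pd 2 (polar_hom \<alpha> g) x + pd i p x =
        R * (g1 t * (- (\<beta> + 1) * cos t * g2 t - sin t * g2' t) + g2 t * (- (\<beta> + 1) * sin t * g2 t + cos t * g2' t)
          + (\<beta> + 1) * sin t * (\<beta>\<^sup>2 + k))"
        unfolding gi[THEN conjunct1] gi[THEN conjunct2] fun_cong[OF u1] fun_cong[OF u2] p_def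
          pd_g2[OF that(1)] pd_P[OF that(1)]
        unfolding polar_hom_def t_def[symmetric] P2 R_def[symmetric] fac[OF R] unfolding \<alpha> ..
      then show ?thesis using bal(2) by simp
    qed
  qed
  have div: "pd 1 (polar_hom \<alpha> g1) x + pd 2 (polar_hom \<alpha> g2) x = 0" if "x \<noteq> 0" for x
  proof -
    define t where "t = angle x"
    have "(- \<alpha> * cos t * g1 t - sin t * g1' t) + (- \<alpha> * sin t * g2 t + cos t * g2' t) = 0"
      unfolding g1_def g2_def g1'_def g2'_def \<alpha> by (simp add: algebra_simps)
    then show ?thesis
      unfolding pd_g1[OF that] pd_g2[OF that] polar_hom_def t_def[symmetric] distrib_left[symmetric]
      by simp
  qed
  \<comment> \<open>The vorticity is minus the Laplacian of the stream function, with profile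
    \<open>- \<beta>\<^sup>2 * w t - z t\<close>; the profile equation leaves only the nonlinear
    term.\<close>
  have curl: "vorticity u x = polar_hom (\<alpha> + 1) (\<lambda>t. k * (1 + 1 / \<beta>) * (w t * M (w t))) x"
    if "x \<noteq> 0" for x
  proof -
    define t where "t = angle x"
    have "(- \<alpha> * c * (s * V + \<beta> * (c * W)) - s * (s * Z - \<beta> * (s * W) + (\<beta> + 1) * (c * V)))
        - (- \<alpha> * s * (c * V + - \<beta> * (s * W)) + c * (c * Z - \<beta> * (c * W) - (\<beta> + 1) * (s * V)))
        = (- \<beta>\<^sup>2 * W - Z) * (c\<^sup>2 + s\<^sup>2)" for c s V W Z
      unfolding \<alpha> by (simp add: algebra_simps power2_eq_square)
    from this[of "cos t" "sin t" "v t" "w t" "z t"]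
    have "(- \<alpha> * cos t * g2 t - sin t * g2' t) - (- \<alpha> * sin t * g1 t + cos t * g1' t) = - \<beta>\<^sup>2 * w t - z t"
      unfolding g1_def g2_def g1'_def g2'_def by simp
    also have "\<dots> = k * (1 + 1 / \<beta>) * (w t * M (w t))" by (simp add: z_def)
    finally show ?thesis
      unfolding vorticity_def u1 u2 pd_g1[OF that] pd_g2[OF that] polar_hom_def t_def[symmetric]
        right_diff_distrib[symmetric]
      by simp
  qed
  have "euler_solution u p"
    unfolding euler_solution_def sum_2 forall_2 u1 u2
    using C_k_Suc_imp[OF u_C] p_C momentum div by simp
  moreover have "neg_homogeneous \<alpha> u p"
    unfolding neg_homogeneous_def
  proof (intro allI ballI impI conjI)
    fix c :: real and x :: "real^2" assume "c > 0"
    then have "c powr a * (c powr - a * y) = y" for a y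
      by (simp add: powr_minus)
    then show "u x = (c powr \<alpha>) *\<^sub>R u (c *\<^sub>R x)" "p x = c powr (2 * \<alpha>) * p (c *\<^sub>R x)"
      unfolding u_def p_def polar_hom_scale[OF \<open>c > 0\<close>] by (simp_all add: vec_eq_iff)
  qed
  moreover have "reflection_symmetric u p"
    unfolding reflection_symmetric_def fun_cong[OF u1] fun_cong[OF u2] p_def
  proof (intro ballI conjI)
    fix x :: "real^2" assume "x \<in> punctured_plane"
    then have x: "x \<noteq> 0" by simp
    have "g1 (- t) = g1 t" "g2 (- t) = - g2 t" for t
      by (simp_all add: g1_def g2_def w_odd v_even)
    then show "polar_hom \<alpha> g1 x = polar_hom \<alpha> g1 (reflect x)"
      "polar_hom \<alpha> g2 x = - polar_hom \<alpha> g2 (reflect x)"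
      "polar_hom (2 * \<alpha>) (\<lambda>_. P) x = polar_hom (2 * \<alpha>) (\<lambda>_. P) (reflect x)"
      unfolding polar_hom_reflect[of g1, OF g1_per x] polar_hom_reflect[of g2, OF g2_per x]
        polar_hom_reflect[of "\<lambda>_. P", OF refl x]
      by (simp_all add: polar_hom_def)
  qed
  moreover have "rotational u"
    unfolding rotational_def
  proof
    \<comment> \<open>This point has angle \<open>pi / 2\<close>, where \<open>w\<close> is
      positive, so the nonlinear term with its factor \<open>k > 0\<close> does not vanish
      there.\<close>
    show "axis 2 1 \<in> punctured_plane" by (simp add: axis_eq_0_iff)
    have x: "axis 2 1 \<noteq> (0 :: real^2)" by (simp add: axis_eq_0_iff)
    have "Complex ((axis 2 1 :: real^2) $ 1) ((axis 2 1 :: real^2) $ 2) = \<i>" by (simp add: axis_def complex_eq_iff)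
    then have angle: "angle (axis 2 1) = pi / 2" by (simp only: Arg_ii)
    have "w (pi / 2) > 0" by (rule w_pos) simp_all
    moreover have "1 + 1 / \<beta> > 0" using \<beta> by (intro add_pos_pos) simp_all
    ultimately show "vorticity u (axis 2 1) \<noteq> 0"
      unfolding curl[OF x] polar_hom_def M_def angle using k x by simp
  qed
  moreover have "stream_function \<alpha> u \<psi>"
    unfolding stream_function_def fun_cong[OF u1] fun_cong[OF u2]
  proof (intro conjI ballI allI impI)
    fix x :: "real^2" assume "x \<in> punctured_plane"
    then have x: "x \<noteq> 0" by simp
    show "\<psi> differentiable (at x)"
      unfolding \<psi>_def using has_derivative_polar_hom[of w v, OF w_per dw x] by (rule differentiableI)
    show "polar_hom \<alpha> g1 x = pd 2 \<psi> x" "polar_hom \<alpha> g2 x = - pd 1 \<psi> x"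
      unfolding \<psi>_def pd_w[OF x] unfolding polar_hom_def g1_def g2_def \<alpha> by (simp_all add: algebra_simps)
  next
    fix c :: real and x :: "real^2" assume "c > 0"
    then show "\<psi> (c *\<^sub>R x) = c powr (1 - \<alpha>) * \<psi> x"
      unfolding \<psi>_def by (simp add: polar_hom_scale \<alpha>)
  qed
  moreover have "level_set \<psi> C homeomorphic level_set \<psi>0 C" for C
    unfolding \<psi>_def \<psi>0_eq
    by (rule level_sets_polar_hom_homeomorphic[OF w_per w_odd w_pos w_cont \<beta>(1)])
      (auto simp: sin_gt_zero intro: continuous_on_sin)
  ultimately show ?thesis
    using u_C unfolding numeral_2_eq_2 by blast
qed

end
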